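(* Let $a\ge2$ be an integer. The orbits of rowmotion on the fence $\breve F(a,a,a,a)$ can be partitioned into four sets $\mathcal S,\mathcal M,\mathcal L,\mathcal G$ having the following properties. (a) We have $$\#\mathcal S=(a-1)^3,\quad \#\mathcal M=a,\quad \#\mathcal L=1,\quad \#\mathcal G=a-1,$$ and $$\#\mathcal O=\begin{cases}a&\text{if }\mathcal O\in\mathcal S,\\ a+1&\text{if }\mathcal O\in\mathcal M,\\ a^2+a+1&\text{if }\mathcal O\in\mathcal L,\\ 3a^2+a&\text{if }\mathcal O\in\mathcal G.\end{cases}$$ (b) The statistics $\chi$ and $\hat\chi$ are homometric under rowmotion, with values $$\chi(\mathcal O)=\begin{cases}4a-4&\text{if }\mathcal O\in\mathcal S,\\ 4a-2&\text{if }\mathcal O\in\mathcal M,\\ 4a^2-a&\text{if }\mathcal O\in\mathcal L,\\ 12a^2-11a+2&\text{if }\mathcal O\in\mathcal G,\end{cases}\qquad \hat\chi(\mathcal O)=\begin{cases}2a^2-a&\text{if }\mathcal O\in\mathcal S,\\ 2a^2+3a-1&\text{if }\mathcal O\in\mathcal M,\\ 2a^3+3a-1&\text{if }\mathcal O\in\mathcal L,\\ 6a^3-a&\text{if }\mathcal O\in\mathcal G.\end{cases}$$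
   Context: The fence $\breve F(a,a,a,a)$ is the poset on $x_1,\dots,x_{4a-1}$ with covering relations $x_1\lhd\cdots\lhd x_a\rhd x_{a+1}\rhd\cdots\rhd x_{2a}\lhd x_{2a+1}\lhd\cdots\lhd x_{3a}\rhd x_{3a+1}\rhd\cdots\rhd x_{4a-1}$. For a finite poset $P$, rowmotion on antichains is the bijection $\rho$ on the set of antichains sending $A$ to the set of minimal elements of $P\setminus I$, where $I$ is the (lower order) ideal generated by $A$. Rowmotion on ideals is the bijection $\hat\rho$ on the set of ideals sending $I$ to the ideal generated by the minimal elements of $P\setminus I$. Orbits are those of the cyclic groups generated by these maps; $A\mapsto$ (ideal generated by $A$) gives a size-preserving bijection between orbits of $\rho$ and of $\hat\rho$, and corresponding orbits are denoted by the same letter. For an orbit $\mathcal O$, $\chi(\mathcal O)=\sum_A\#A$ over the antichains in the orbit, and $\hat\chi(\mathcal O)=\sum_I\#I$ over the ideals in the orbit. A statistic $\mathrm{st}$ is homometric if $\#\mathcal O_1=\#\mathcal O_2$ implies $\mathrm{st}(\mathcal O_1)=\mathrm{st}(\mathcal O_2)$ for all orbits $\mathcal O_1,\mathcal O_2$, where $\mathrm{st}(\mathcal O)$ is the sum of $\mathrm{st}$ over $\mathcal O$. *)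

theory Defs
  imports Main "HOL-Combinatorics.Orbits"
begin

text \<open>A poset is a carrier set \<open>P\<close> with a relation \<open>r\<close> such that
  \<^prop>\<open>partial_order_on P r\<close>; \<open>(x, y) \<in> r\<close> means that \<open>x\<close> is less than or equal to \<open>y\<close>.\<close>

definition antichains :: "'a set \<Rightarrow> 'a rel \<Rightarrow> 'a set set" where
  "antichains P r = {A. A \<subseteq> P \<and> (\<forall>x\<in>A. \<forall>y\<in>A. (x, y) \<in> r \<longrightarrow> x = y)}"

definition ideals :: "'a set \<Rightarrow> 'a rel \<Rightarrow> 'a set set" where
  "ideals P r = {I. I \<subseteq> P \<and> (\<forall>y\<in>I. \<forall>x\<in>P. (x, y) \<in> r \<longrightarrow> x \<in> I)}"

definition generated_ideal :: "'a set \<Rightarrow> 'a rel \<Rightarrow> 'a set \<Rightarrow> 'a set" where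
  "generated_ideal P r A = {x \<in> P. \<exists>y\<in>A. (x, y) \<in> r}"

definition minimal_elements :: "'a rel \<Rightarrow> 'a set \<Rightarrow> 'a set" where
  "minimal_elements r X = {x \<in> X. \<forall>y\<in>X. (y, x) \<in> r \<longrightarrow> y = x}"

definition rowmotion :: "'a set \<Rightarrow> 'a rel \<Rightarrow> 'a set \<Rightarrow> 'a set" where
  "rowmotion P r A = minimal_elements r (P - generated_ideal P r A)"

definition ideal_rowmotion :: "'a set \<Rightarrow> 'a rel \<Rightarrow> 'a set \<Rightarrow> 'a set" where
  "ideal_rowmotion P r I = generated_ideal P r (minimal_elements r (P - I))"

text \<open>\<^const>\<open>orbit\<close> collects the positive iterates. On a finite poset both maps are bijections
  of finite sets (\<open>bij_betw_rowmotion\<close> and \<open>bij_betw_ideal_rowmotion\<close> below), so these are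
  the orbits of the cyclic groups they generate.\<close>

definition antichain_orbits :: "'a set \<Rightarrow> 'a rel \<Rightarrow> 'a set set set" where
  "antichain_orbits P r = orbit (rowmotion P r) ` antichains P r"

definition ideal_orbits :: "'a set \<Rightarrow> 'a rel \<Rightarrow> 'a set set set" where
  "ideal_orbits P r = orbit (ideal_rowmotion P r) ` ideals P r"

text \<open>The orbit of ideals corresponding to an orbit of antichains; see
  \<open>bij_betw_ideal_orbit\<close> and \<open>card_ideal_orbit\<close> below.\<close>

definition ideal_orbit :: "'a set \<Rightarrow> 'a rel \<Rightarrow> 'a set set \<Rightarrow> 'a set set" where
  "ideal_orbit P r Orb = generated_ideal P r ` Orb"

definition chi :: "'a set set \<Rightarrow> nat" where
  "chi Orb = (\<Sum>A\<in>Orb. card A)"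

definition chi_hat :: "'a set \<Rightarrow> 'a rel \<Rightarrow> 'a set set \<Rightarrow> nat" where
  "chi_hat P r Orb = (\<Sum>I\<in>ideal_orbit P r Orb. card I)"

definition homometric :: "'b set set \<Rightarrow> ('b \<Rightarrow> nat) \<Rightarrow> bool" where
  "homometric Orbs st \<longleftrightarrow>
     (\<forall>O1\<in>Orbs. \<forall>O2\<in>Orbs. card O1 = card O2 \<longrightarrow> sum st O1 = sum st O2)"


text \<open>The fence with four segments: the index \<open>i\<close> stands for \<open>x\<^sub>i\<close>.\<close>

definition fence_carrier :: "nat \<Rightarrow> nat set" where
  "fence_carrier a = {1..4 * a - 1}"

definition fence_covers :: "nat \<Rightarrow> nat rel" where
  "fence_covers a =
     {(i, i + 1) | i. 1 \<le> i \<and> i < a} \<union>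
     {(i + 1, i) | i. a \<le> i \<and> i < 2 * a} \<union>
     {(i, i + 1) | i. 2 * a \<le> i \<and> i < 3 * a} \<union>
     {(i + 1, i) | i. 3 * a \<le> i \<and> i < 4 * a - 1}"

definition fence_order :: "nat \<Rightarrow> nat rel" where
  "fence_order a = Restr ((fence_covers a)\<^sup>*) (fence_carrier a)"


lemma partial_order_on_fence: "partial_order_on (fence_carrier a) (fence_order a)"
proof -
  define h where "h i = (if i \<le> a then int i else if i \<le> 2 * a then 2 * int a - int i
     else if i \<le> 3 * a then int i - 2 * int a else 4 * int a - int i)" for i
  have step: "h x < h y" if "(x, y) \<in> fence_covers a" for x y
    using that unfolding fence_covers_def h_def by auto
  have mono: "x = y \<or> h x < h y" if "(x, y) \<in> (fence_covers a)\<^sup>*" for x y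
    using that by (induction rule: rtrancl_induct) (auto dest: step)
  show ?thesis
    unfolding partial_order_on_def preorder_on_def refl_on_def fence_order_def
    by (auto intro!: transI antisymI intro: rtrancl_trans) (metis mono less_asym)
qed

context
  fixes P :: "'a set" and r :: "'a rel"
  assumes fin: "finite P" and po: "partial_order_on P r"
begin

private lemma poD:
  shows "x \<in> P \<Longrightarrow> (x, x) \<in> r"
    and "(x, y) \<in> r \<Longrightarrow> (y, z) \<in> r \<Longrightarrow> (x, z) \<in> r"
    and "(x, y) \<in> r \<Longrightarrow> (y, x) \<in> r \<Longrightarrow> x = y"
  using partial_order_onD[OF po] unfolding refl_on_def trans_def antisym_def by blast+

private lemma above_minimal:
  assumes "X \<subseteq> P" "x \<in> X"
  obtains m where "m \<in> minimal_elements r X" "(m, x) \<in> r"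
proof -
  have "wf (r - Id)"
    using partial_order_on_well_order_on[OF _ po] partial_order_onD(4)[OF po] fin
    by (meson finite_SigmaI finite_subset)
  moreover have "x \<in> {y \<in> X. (y, x) \<in> r}" using assms poD(1) by auto
  ultimately obtain m where m: "m \<in> {y \<in> X. (y, x) \<in> r}"
      "\<And>y. (y, m) \<in> r - Id \<Longrightarrow> y \<notin> {y \<in> X. (y, x) \<in> r}"
    by (rule wfE_min) blast
  have "m \<in> minimal_elements r X"
    unfolding minimal_elements_def using m poD(2) by blast
  with m show ?thesis using that by blast
qed

private lemma rowmotion_in: "rowmotion P r A \<in> antichains P r"
  unfolding rowmotion_def minimal_elements_def antichains_def by auto

private lemma generated_in: "generated_ideal P r A \<in> ideals P r"
  unfolding generated_ideal_def ideals_def using poD(2) by blast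

private lemma ideal_rowmotion_in: "ideal_rowmotion P r I \<in> ideals P r"
  unfolding ideal_rowmotion_def by (rule generated_in)

private lemma inj_generated: "inj_on (generated_ideal P r) (antichains P r)"
proof -
  have "A \<subseteq> B" if "generated_ideal P r A = generated_ideal P r B"
    "A \<in> antichains P r" "B \<in> antichains P r" for A B
  proof
    fix x assume x: "x \<in> A"
    then have "x \<in> P" using that(2) unfolding antichains_def by blast
    with x have "x \<in> generated_ideal P r A"
      using poD(1) unfolding generated_ideal_def by blast
    with that(1) have "x \<in> generated_ideal P r B" by simp
    then obtain y where y: "y \<in> B" "(x, y) \<in> r"
      unfolding generated_ideal_def by blast
    have "y \<in> P" using y that(3) unfolding antichains_def by blast
    with y have "y \<in> generated_ideal P r B"
      using poD(1) unfolding generated_ideal_def by blast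
    with that(1) have "y \<in> generated_ideal P r A" by simp
    then obtain z where z: "z \<in> A" "(y, z) \<in> r"
      unfolding generated_ideal_def by blast
    have "x = z" using x y z that(2) poD(2) unfolding antichains_def by blast
    then show "x \<in> B" using y z poD(3) by blast
  qed
  then show ?thesis by (metis inj_onI subset_antisym)
qed

private lemma complement_eq:
  assumes "I \<in> ideals P r"
  shows "I = P - {x \<in> P. \<exists>m\<in>minimal_elements r (P - I). (m, x) \<in> r}"
proof -
  have "\<exists>m\<in>minimal_elements r (P - I). (m, x) \<in> r" if "x \<in> P - I" for x
    using above_minimal[of "P - I" x] that by blast
  moreover have "I \<subseteq> P" using assms unfolding ideals_def by auto
  moreover have "x \<notin> I" if "x \<in> P" "m \<in> minimal_elements r (P - I)" "(m, x) \<in> r" for x m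
    using that assms unfolding ideals_def minimal_elements_def by blast
  ultimately show ?thesis by blast
qed

private lemma ideal_eqI:
  assumes "I \<in> ideals P r" "J \<in> ideals P r"
    and eq: "minimal_elements r (P - I) = minimal_elements r (P - J)"
  shows "I = J"
proof -
  have "I = P - {x \<in> P. \<exists>m\<in>minimal_elements r (P - I). (m, x) \<in> r}"
    by (rule complement_eq[OF assms(1)])
  also have "\<dots> = P - {x \<in> P. \<exists>m\<in>minimal_elements r (P - J). (m, x) \<in> r}"
    by (simp only: eq)
  also have "\<dots> = J" by (rule complement_eq[OF assms(2), symmetric])
  finally show ?thesis .
qed

private lemma finite_sets: "finite (antichains P r)" "finite (ideals P r)"
  unfolding antichains_def ideals_def using fin by auto

lemma bij_betw_rowmotion: "bij_betw (rowmotion P r) (antichains P r) (antichains P r)"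
proof -
  have "generated_ideal P r A = generated_ideal P r B" if "rowmotion P r A = rowmotion P r B" for A B
    using that unfolding rowmotion_def by (rule ideal_eqI[OF generated_in generated_in])
  then have "inj_on (rowmotion P r) (antichains P r)"
    by (intro inj_onI) (rule inj_onD[OF inj_generated])
  then show ?thesis
    using finite_sets(1) rowmotion_in
    by (simp add: bij_betw_def endo_inj_surj image_subset_iff)
qed

lemma bij_betw_ideal_rowmotion: "bij_betw (ideal_rowmotion P r) (ideals P r) (ideals P r)"
proof -
  have "minimal_elements r (P - I) \<in> antichains P r" for I
    unfolding minimal_elements_def antichains_def by auto
  then have *: "minimal_elements r (P - I) = minimal_elements r (P - J)"
    if "ideal_rowmotion P r I = ideal_rowmotion P r J" for I J
    using inj_onD[OF inj_generated that[unfolded ideal_rowmotion_def]] by blast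
  have "inj_on (ideal_rowmotion P r) (ideals P r)"
  proof (rule inj_onI)
    fix I J assume "I \<in> ideals P r" "J \<in> ideals P r"
      "ideal_rowmotion P r I = ideal_rowmotion P r J"
    then show "I = J"
      using ideal_eqI * by blast
  qed
  then show ?thesis
    using finite_sets(2) ideal_rowmotion_in
    by (simp add: bij_betw_def endo_inj_surj image_subset_iff)
qed

private lemma orbit_in_antichains:
  assumes "A \<in> antichains P r" shows "orbit (rowmotion P r) A \<subseteq> antichains P r"
proof
  fix B assume "B \<in> orbit (rowmotion P r) A"
  then show "B \<in> antichains P r" by cases (simp_all add: rowmotion_in)
qed

private lemma generated_surj: "generated_ideal P r ` antichains P r = ideals P r"
proof -
  have "ideals P r = ideal_rowmotion P r ` ideals P r"
    using bij_betw_ideal_rowmotion by (simp add: bij_betw_def)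
  also have "\<dots> \<subseteq> generated_ideal P r ` antichains P r"
    unfolding ideal_rowmotion_def minimal_elements_def antichains_def by auto
  finally show ?thesis using generated_in by blast
qed

private lemma ideal_orbit_eq:
  "ideal_orbit P r (orbit (rowmotion P r) A) =
     orbit (ideal_rowmotion P r) (generated_ideal P r A)"
proof -
  have *: "generated_ideal P r ((rowmotion P r ^^ n) A) =
      (ideal_rowmotion P r ^^ n) (generated_ideal P r A)" for n
    by (induction n) (simp_all add: rowmotion_def ideal_rowmotion_def)
  then show ?thesis
    unfolding ideal_orbit_def orbit_altdef by (auto simp: image_iff)
qed

lemma card_ideal_orbit:
  assumes "Orb \<in> antichain_orbits P r"
  shows "card (ideal_orbit P r Orb) = card Orb"
  using assms orbit_in_antichains inj_on_subset[OF inj_generated]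
  unfolding antichain_orbits_def ideal_orbit_def by (auto intro!: card_image)

lemma bij_betw_ideal_orbit:
  "bij_betw (ideal_orbit P r) (antichain_orbits P r) (ideal_orbits P r)"
proof -
  have "antichain_orbits P r \<subseteq> Pow (antichains P r)"
    using orbit_in_antichains unfolding antichain_orbits_def by auto
  then have "inj_on (ideal_orbit P r) (antichain_orbits P r)"
    unfolding ideal_orbit_def
    by (rule inj_on_subset[OF inj_on_image_Pow[OF inj_generated]])
  moreover have "ideal_orbit P r ` antichain_orbits P r = ideal_orbits P r"
    unfolding antichain_orbits_def ideal_orbits_def generated_surj[symmetric]
    by (simp add: image_image ideal_orbit_eq)
  ultimately show ?thesis by (simp add: bij_betw_def)
qed

end

end

theory Submission
  imports Defs
begin

text \<open>
  An ideal of the fence is described by how far it reaches up each of the four arms. Rowmotion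
  advances each of these four counters cyclically with period \<open>a\<close>, with one exception: when two
  neighbouring counters, which share a peak or the bottom of the valley, are full at the same time,
  both of them pause for one step, during which the peak is present or the valley is empty. (The
  middle pair does not pause if a peak is added at that moment.) So a pair of neighbouring counters
  that agree has period \<open>a + 1\<close>.

  If no two neighbours agree, all counters have period \<open>a\<close> for ever, and these are the orbits in \<open>S\<close>.
  If exactly the two outer pairs agree, the whole state has period \<open>a + 1\<close>, which gives \<open>M\<close>.
  Otherwise the agreeing pair drifts against the other counters by one unit per turn. If the left
  pair agrees and the fourth counter is ahead of the third one by \<open>c\<close>, then the drift lasts for
  \<open>a (a + 1)\<close> steps, until the middle pair meets; then the middle pair drifts for
  \<open>(a - 1 - c) (a + 1) + 1\<close> steps, until it meets the fourth counter, and the right pair takes over,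
  with the first counter ahead of the second one by \<open>a - c\<close>. By left-right symmetry the second half
  of the orbit is the mirror image of a first half for \<open>a - c\<close>, which gives the orbits in \<open>G\<close>. The
  orbit on which all four counters meet forms \<open>L\<close>. All sums are sums of functions of a single
  counter over full turns.
\<close>

section \<open>The fence and its ideals\<close>

text \<open>Peaks have no upper covers and the valley has no lower ones, so a chain of covers cannot
  turn around and stays inside one of the four monotone segments.\<close>

lemma fence_order_iff:
  assumes "2 \<le> a"
  shows "(x, y) \<in> fence_order a \<longleftrightarrow> 1 \<le> x \<and> x < 4 * a \<and> 1 \<le> y \<and> y < 4 * a \<and>
    (x \<le> y \<and> y \<le> a \<or> a \<le> y \<and> y \<le> x \<and> x \<le> 2 * a \<or>
     2 * a \<le> x \<and> x \<le> y \<and> y \<le> 3 * a \<or> 3 * a \<le> y \<and> y \<le> x)"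
    (is "_ \<longleftrightarrow> _ \<and> _ \<and> _ \<and> _ \<and> ?R x y")
proof -
  have up: "(x, y) \<in> (fence_covers a)\<^sup>*"
    if "x \<le> y" "\<And>i. x \<le> i \<Longrightarrow> i < y \<Longrightarrow> (i, Suc i) \<in> fence_covers a" for x y
    using that by (induction y rule: dec_induct) (auto intro: rtrancl_into_rtrancl)
  have down: "(y, x) \<in> (fence_covers a)\<^sup>*"
    if "x \<le> y" "\<And>i. x \<le> i \<Longrightarrow> i < y \<Longrightarrow> (Suc i, i) \<in> fence_covers a" for x y
    using that by (induction y rule: dec_induct) (auto intro: converse_rtrancl_into_rtrancl)
  have "?R x y" if "(x, y) \<in> (fence_covers a)\<^sup>*" "1 \<le> x" "x < 4 * a"
    using that(1)
  proof (induction rule: rtrancl_induct)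
    case base
    then show ?case using that(2,3) by linarith
  next
    case (step y z)
    from step(2,3) show ?case unfolding fence_covers_def by auto
  qed
  moreover have "(x, y) \<in> (fence_covers a)\<^sup>*" if "?R x y" "1 \<le> x" "x < 4 * a" "1 \<le> y"
  proof -
    from that(1) consider "x \<le> y" "y \<le> a" | "a \<le> y" "y \<le> x" "x \<le> 2 * a"
      | "2 * a \<le> x" "x \<le> y" "y \<le> 3 * a" | "3 * a \<le> y" "y \<le> x" by blast
    then show ?thesis
    proof cases
      case 1 then show ?thesis using that by (intro up) (auto simp: fence_covers_def)
    next
      case 2 then show ?thesis using that by (intro down) (auto simp: fence_covers_def)
    next
      case 3 then show ?thesis using that by (intro up) (auto simp: fence_covers_def)
    next
      case 4 then show ?thesis using that by (intro down) (auto simp: fence_covers_def)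
    qed
  qed
  moreover have carrier: "z \<in> {1..4 * a - 1} \<longleftrightarrow> 1 \<le> z \<and> z < 4 * a" for z
    using assms by auto
  ultimately show ?thesis
    unfolding fence_order_def fence_carrier_def using carrier by blast
qed

text \<open>Along one arm, counted from its bottom, an ideal is downward closed; this turns its
  trace on the arm into a single counter, with 0 for an empty trace.\<close>

lemma initial_segment:
  fixes Q :: "nat \<Rightarrow> bool"
  assumes "\<And>x. 0 < x \<Longrightarrow> Suc x < n \<Longrightarrow> Q (Suc x) \<Longrightarrow> Q x" "0 < n"
  obtains i where "i < n" "\<And>x. 0 < x \<Longrightarrow> x < n \<Longrightarrow> Q x \<longleftrightarrow> x \<le> i"
proof -
  from assms have "\<exists>i<n. \<forall>x. 0 < x \<and> x < n \<longrightarrow> (Q x \<longleftrightarrow> x \<le> i)"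
  proof (induction n)
    case (Suc n)
    show ?case
    proof (cases "n = 0")
      case False
      with Suc obtain i where i: "i < n" "\<And>x. 0 < x \<and> x < n \<Longrightarrow> (Q x \<longleftrightarrow> x \<le> i)"
        by (metis less_Suc_eq neq0_conv)
      show ?thesis
      proof (cases "Q n")
        case True
        have "Q x" if "0 < x" "x \<le> n" for x
          using that(2,1) True Suc.prems(1)
          by (induction x rule: inc_induct) auto
        then show ?thesis by (intro exI[of _ n]) (auto simp: less_Suc_eq_le)
      next
        case False
        with i show ?thesis by (intro exI[of _ i]) (auto simp: less_Suc_eq)
      qed
    qed auto
  qed auto
  with that show ?thesis by blast
qed

text \<open>
  Counters are listed from left to right and take values in \<open>{0..<a}\<close>; those of the two middle arms
  do not count the valley element \<open>2 * a\<close>. In \<open>N\<close> the valley is present and both peaks are absent;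
  in \<open>LP\<close>, \<open>RP\<close>, \<open>PP\<close> the left, the right or both peaks are present, so that the two adjacent
  arms are full; in \<open>E\<close> the valley is absent, so that the two middle arms are empty.
\<close>

datatype state = N nat nat nat nat | LP nat nat | RP nat nat | PP | E nat nat


fun valid_state :: "nat \<Rightarrow> state \<Rightarrow> bool" where
  "valid_state a (N i j k l) \<longleftrightarrow> i < a \<and> j < a \<and> k < a \<and> l < a"
| "valid_state a (LP k l) \<longleftrightarrow> k < a \<and> l < a"
| "valid_state a (RP i j) \<longleftrightarrow> i < a \<and> j < a"
| "valid_state a PP \<longleftrightarrow> True"
| "valid_state a (E i l) \<longleftrightarrow> i < a \<and> l < a"

fun ideal_of :: "nat \<Rightarrow> state \<Rightarrow> nat set" where
  "ideal_of a (N i j k l) = {1..i} \<union> {2 * a - j..2 * a + k} \<union> {4 * a - l..4 * a - 1}"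
| "ideal_of a (LP k l) = {1..2 * a + k} \<union> {4 * a - l..4 * a - 1}"
| "ideal_of a (RP i j) = {1..i} \<union> {2 * a - j..4 * a - 1}"
| "ideal_of a PP = {1..4 * a - 1}"
| "ideal_of a (E i l) = {1..i} \<union> {4 * a - l..4 * a - 1}"

text \<open>With all four counters defined for every constructor, later proofs can argue by position
  in the fence. Arms under a present peak count \<open>a - 1\<close>, and the middle arms count 0 in
  \<open>E\<close>.\<close>

fun h1 :: "nat \<Rightarrow> state \<Rightarrow> nat" where
  "h1 a (N i j k l) = i" | "h1 a (LP k l) = a - 1" | "h1 a (RP i j) = i" | "h1 a PP = a - 1" | "h1 a (E i l) = i"

fun h2 :: "nat \<Rightarrow> state \<Rightarrow> nat" where
  "h2 a (N i j k l) = j" | "h2 a (LP k l) = a - 1" | "h2 a (RP i j) = j" | "h2 a PP = a - 1" | "h2 a (E i l) = 0"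

fun h3 :: "nat \<Rightarrow> state \<Rightarrow> nat" where
  "h3 a (N i j k l) = k" | "h3 a (LP k l) = k" | "h3 a (RP i j) = a - 1" | "h3 a PP = a - 1" | "h3 a (E i l) = 0"

fun h4 :: "nat \<Rightarrow> state \<Rightarrow> nat" where
  "h4 a (N i j k l) = l" | "h4 a (LP k l) = l" | "h4 a (RP i j) = a - 1" | "h4 a PP = a - 1" | "h4 a (E i l) = l"

fun valley :: "state \<Rightarrow> bool" where
  "valley (E i l) = False" | "valley _ = True"

fun peak1 :: "state \<Rightarrow> bool" where
  "peak1 (LP k l) = True" | "peak1 PP = True" | "peak1 _ = False"

fun peak2 :: "state \<Rightarrow> bool" where
  "peak2 (RP i j) = True" | "peak2 PP = True" | "peak2 _ = False"

definition antichain_of :: "nat \<Rightarrow> state \<Rightarrow> nat set" where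
  "antichain_of a s = {x.
     x = Suc (h1 a s) \<and> Suc (h1 a s) < a \<or>
     x = 2 * a - Suc (h2 a s) \<and> Suc (h2 a s) < a \<and> valley s \<or>
     x = 2 * a + Suc (h3 a s) \<and> Suc (h3 a s) < a \<and> valley s \<or>
     x = 4 * a - Suc (h4 a s) \<and> Suc (h4 a s) < a \<or>
     x = 2 * a \<and> \<not> valley s \<or>
     x = a \<and> Suc (h1 a s) = a \<and> Suc (h2 a s) = a \<and> \<not> peak1 s \<or>
     x = 3 * a \<and> Suc (h3 a s) = a \<and> Suc (h4 a s) = a \<and> \<not> peak2 s}"

definition nx :: "nat \<Rightarrow> nat \<Rightarrow> nat" where "nx a x = Suc x mod a"

text \<open>A full arm falls back to 0 because none of its elements is minimal outside the ideal,
  unless a peak regenerates it. The tests for peaks precede the one for the middle pair, since a new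
  peak regenerates the valley and the middle arm below it.\<close>

fun step :: "nat \<Rightarrow> state \<Rightarrow> state" where
  "step a (N i j k l) =
     (if i = a - 1 \<and> j = a - 1
      then if k = a - 1 \<and> l = a - 1 then PP else LP (nx a k) (nx a l)
      else if k = a - 1 \<and> l = a - 1 then RP (nx a i) (nx a j)
      else if j = a - 1 \<and> k = a - 1 then E (nx a i) (nx a l)
      else N (nx a i) (nx a j) (nx a k) (nx a l))"
| "step a (LP k l) =
     (if k = a - 1 then if l = a - 1 then RP 0 0 else E 0 (nx a l) else N 0 0 (nx a k) (nx a l))"
| "step a (RP i j) =
     (if j = a - 1 then if i = a - 1 then LP 0 0 else E (nx a i) 0 else N (nx a i) (nx a j) 0 0)"
| "step a PP = E 0 0"
| "step a (E i l) = N (nx a i) 0 0 (nx a l)"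

section \<open>Local descriptions of the order, the ideals and the antichains\<close>

context
  fixes a :: nat
  assumes a2: "2 \<le> a"
begin

lemma nx_eq: "x < a \<Longrightarrow> nx a x = (if x = a - 1 then 0 else Suc x)"
  unfolding nx_def using a2 by (auto simp: mod_Suc)

lemma ideal_of_in: "valid_state a s \<Longrightarrow> ideal_of a s \<in> ideals (fence_carrier a) (fence_order a)"
  using a2 by (cases s) (auto simp: ideals_def fence_carrier_def fence_order_iff[OF a2])

text \<open>Everything strictly below \<open>x\<close> lies below a lower cover of \<open>x\<close>,
  so minimality outside an ideal can be tested on neighbours. The ends and the valley have no lower
  cover to test, the peaks have two.\<close>

lemma minimal_elements_ideal_iff:
  assumes "I \<in> ideals (fence_carrier a) (fence_order a)"
  shows "x \<in> minimal_elements (fence_order a) (fence_carrier a - I) \<longleftrightarrow> x \<in> fence_carrier a - I \<and>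
    (1 < x \<and> x \<le> a \<longrightarrow> x - 1 \<in> I) \<and> (a \<le> x \<and> x < 2 * a \<longrightarrow> Suc x \<in> I) \<and>
    (2 * a < x \<and> x \<le> 3 * a \<longrightarrow> x - 1 \<in> I) \<and> (3 * a \<le> x \<and> Suc x < 4 * a \<longrightarrow> Suc x \<in> I)"
    (is "_ \<longleftrightarrow> _ \<and> ?c x")
proof
  assume x: "x \<in> minimal_elements (fence_order a) (fence_carrier a - I)"
  then have below: "y \<in> I" if "(y, x) \<in> fence_order a" "y \<noteq> x" for y
    using that unfolding minimal_elements_def fence_order_def by blast
  have carrier: "x \<in> fence_carrier a - I" using x unfolding minimal_elements_def by blast
  then have bounds: "1 \<le> x" "x < 4 * a" using a2 by (auto simp: fence_carrier_def)
  have "?c x"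
    by (intro conjI impI; rule below; use a2 bounds in \<open>simp add: fence_order_iff[OF a2]; linarith\<close>)
  with carrier show "x \<in> fence_carrier a - I \<and> ?c x" ..
next
  assume x: "x \<in> fence_carrier a - I \<and> ?c x"
  have "y \<in> I" if "y \<in> fence_carrier a" "(y, x) \<in> fence_order a" "y \<noteq> x" for y
  proof -
    \<comment> \<open>The witness is the neighbour of \<open>x\<close> on the side of
      \<open>y\<close>, a lower cover of \<open>x\<close> that the local condition puts into
      \<open>I\<close>.\<close>
    have "\<exists>z \<in> I. (y, z) \<in> fence_order a"
    proof -
      have "y < x \<and> x \<le> a \<or> a \<le> x \<and> x < y \<and> y \<le> 2 * a
        \<or> 2 * a \<le> y \<and> y < x \<and> x \<le> 3 * a \<or> 3 * a \<le> x \<and> x < y"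
        using that(2,3) unfolding fence_order_iff[OF a2] by linarith
      then consider "y < x" "x \<le> a" | "a \<le> x" "x < y" "y \<le> 2 * a"
        | "2 * a \<le> y" "y < x" "x \<le> 3 * a" | "3 * a \<le> x" "x < y" by blast
      then show ?thesis
      proof cases
        case 1 then show ?thesis using x that a2
          by (intro bexI[of _ "x - 1"]) (auto simp: fence_order_iff fence_carrier_def)
      next
        case 2 then show ?thesis using x that a2
          by (intro bexI[of _ "Suc x"]) (auto simp: fence_order_iff fence_carrier_def)
      next
        case 3 then show ?thesis using x that a2
          by (intro bexI[of _ "x - 1"]) (auto simp: fence_order_iff fence_carrier_def)
      next
        case 4 then show ?thesis using x that a2
          by (intro bexI[of _ "Suc x"]) (auto simp: fence_order_iff fence_carrier_def)
      qed
    qed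
    with assms that show ?thesis unfolding ideals_def by blast
  qed
  with x show "x \<in> minimal_elements (fence_order a) (fence_carrier a - I)"
    unfolding minimal_elements_def by blast
qed

lemma fence_cases:
  assumes "x \<in> fence_carrier a"
  obtains "0 < x" "x < a" | "a < x" "x < 2 * a" | "2 * a < x" "x < 3 * a" | "3 * a < x" "x < 4 * a"
    | "x = a" | "x = 2 * a" | "x = 3 * a"
  using assms a2 unfolding fence_carrier_def atLeastAtMost_iff by linarith

lemma ideal_of_arms:
  assumes "valid_state a s"
  shows "0 < x \<Longrightarrow> x < a \<Longrightarrow> x \<in> ideal_of a s \<longleftrightarrow> x \<le> h1 a s"
    and "a < x \<Longrightarrow> x < 2 * a \<Longrightarrow> x \<in> ideal_of a s \<longleftrightarrow> valley s \<and> 2 * a \<le> x + h2 a s"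
    and "2 * a < x \<Longrightarrow> x < 3 * a \<Longrightarrow> x \<in> ideal_of a s \<longleftrightarrow> valley s \<and> x \<le> 2 * a + h3 a s"
    and "3 * a < x \<Longrightarrow> x < 4 * a \<Longrightarrow> x \<in> ideal_of a s \<longleftrightarrow> 4 * a \<le> x + h4 a s"
    and "2 * a \<in> ideal_of a s \<longleftrightarrow> valley s"
    and "a \<in> ideal_of a s \<longleftrightarrow> peak1 s"
    and "3 * a \<in> ideal_of a s \<longleftrightarrow> peak2 s"
  using assms a2 by (cases s; auto)+

lemma heights:
  assumes "valid_state a s"
  shows "h1 a s < a" "h2 a s < a" "h3 a s < a" "h4 a s < a"
   "peak1 s \<Longrightarrow> Suc (h1 a s) = a \<and> Suc (h2 a s) = a \<and> valley s"
   "peak2 s \<Longrightarrow> Suc (h3 a s) = a \<and> Suc (h4 a s) = a \<and> valley s"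
   "\<not> valley s \<Longrightarrow> h2 a s = 0 \<and> h3 a s = 0"
  using assms a2 by (cases s; auto)+

lemma antichain_of_arms:
  assumes "valid_state a s"
  shows "0 < x \<Longrightarrow> x < a \<Longrightarrow> x \<in> antichain_of a s \<longleftrightarrow> x = Suc (h1 a s)"
    and "a < x \<Longrightarrow> x < 2 * a \<Longrightarrow> x \<in> antichain_of a s \<longleftrightarrow> valley s \<and> 2 * a = x + Suc (h2 a s)"
    and "2 * a < x \<Longrightarrow> x < 3 * a \<Longrightarrow> x \<in> antichain_of a s \<longleftrightarrow> valley s \<and> x = 2 * a + Suc (h3 a s)"
    and "3 * a < x \<Longrightarrow> x < 4 * a \<Longrightarrow> x \<in> antichain_of a s \<longleftrightarrow> 4 * a = x + Suc (h4 a s)"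
    and "2 * a \<in> antichain_of a s \<longleftrightarrow> \<not> valley s"
    and "a \<in> antichain_of a s \<longleftrightarrow> Suc (h1 a s) = a \<and> Suc (h2 a s) = a \<and> \<not> peak1 s"
    and "3 * a \<in> antichain_of a s \<longleftrightarrow> Suc (h3 a s) = a \<and> Suc (h4 a s) = a \<and> \<not> peak2 s"
  unfolding antichain_of_def mem_Collect_eq using heights(1-4)[OF assms] a2
  by - (rule iffI; (elim disjE conjE)?; auto)+

end

section \<open>Rowmotion on states\<close>

context
  fixes a :: nat
  assumes a2: "2 \<le> a"
begin

lemma valid_state_step:
  assumes "valid_state a s"
  shows "valid_state a (step a s)"
  using assms a2 by (cases s) (auto simp: nx_def)

text \<open>Only the neighbours of a position matter, and their membership is read off the counters;
  the proof runs through the four open arms and the three turning points.\<close>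

lemma minimal_elements_ideal_of:
  assumes s: "valid_state a s"
  shows "minimal_elements (fence_order a) (fence_carrier a - ideal_of a s) = antichain_of a s"
proof (rule set_eqI)
  fix x
  note [simp] = ideal_of_arms[OF a2 s] antichain_of_arms[OF a2 s]
  note h = heights[OF a2 s]
  show "x \<in> minimal_elements (fence_order a) (fence_carrier a - ideal_of a s) \<longleftrightarrow> x \<in> antichain_of a s"
  proof (cases "x \<in> fence_carrier a")
    case False
    then have "x \<notin> antichain_of a s"
      using h a2 by (auto simp: fence_carrier_def antichain_of_def)
    with False show ?thesis by (simp add: minimal_elements_ideal_iff[OF a2 ideal_of_in[OF a2 s]])
  next
    case True
    from fence_cases[OF a2 True]
    have "(x \<notin> ideal_of a s \<and>
    (1 < x \<and> x \<le> a \<longrightarrow> x - 1 \<in> ideal_of a s) \<and> (a \<le> x \<and> x < 2 * a \<longrightarrow> Suc x \<in> ideal_of a s) \<and>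
    (2 * a < x \<and> x \<le> 3 * a \<longrightarrow> x - 1 \<in> ideal_of a s) \<and>
    (3 * a \<le> x \<and> Suc x < 4 * a \<longrightarrow> Suc x \<in> ideal_of a s)) \<longleftrightarrow> x \<in> antichain_of a s"
    proof cases
      \<comment> \<open>In each arm the bottom element is treated apart: its lower cover is missing
        or is the valley.\<close>
      case 1 then show ?thesis using h(1) by (cases "x = 1") auto
    next
      case 2 then show ?thesis using h(2,7) by (cases "Suc x = 2 * a") auto
    next
      case 3 then show ?thesis using h(3,7) by (cases "x - 1 = 2 * a") auto
    next
      case 4 then show ?thesis using h(4) by (cases "Suc x = 4 * a") auto
    next
      case 5 then show ?thesis using h(1,2,7) a2 by (cases "valley s") auto
    next
      case 6 then show ?thesis using a2 by auto
    next
      case 7 then show ?thesis using h(3,4,7) a2 by (cases "valley s") auto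
    qed
    with True show ?thesis by (simp add: minimal_elements_ideal_iff[OF a2 ideal_of_in[OF a2 s]])
  qed
qed

lemma fence_order_arms:
  shows "0 < y \<Longrightarrow> y < a \<Longrightarrow> (x, y) \<in> fence_order a \<longleftrightarrow> 0 < x \<and> x \<le> y"
    and "a < y \<Longrightarrow> y < 2 * a \<Longrightarrow> (x, y) \<in> fence_order a \<longleftrightarrow> y \<le> x \<and> x \<le> 2 * a"
    and "2 * a < y \<Longrightarrow> y < 3 * a \<Longrightarrow> (x, y) \<in> fence_order a \<longleftrightarrow> 2 * a \<le> x \<and> x \<le> y"
    and "3 * a < y \<Longrightarrow> y < 4 * a \<Longrightarrow> (x, y) \<in> fence_order a \<longleftrightarrow> y \<le> x \<and> x < 4 * a"
    and "(x, a) \<in> fence_order a \<longleftrightarrow> 0 < x \<and> x \<le> 2 * a"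
    and "(x, 2 * a) \<in> fence_order a \<longleftrightarrow> x = 2 * a"
    and "(x, 3 * a) \<in> fence_order a \<longleftrightarrow> 2 * a \<le> x \<and> x < 4 * a"
  unfolding fence_order_iff[OF a2] using a2 by linarith+

text \<open>A generated ideal is the union of the principal ideals of its generators, and each kind
  of generator contributes one disjunct.\<close>

lemma generated_ideal_antichain_of_iff:
  assumes s: "valid_state a s"
  shows "x \<in> generated_ideal (fence_carrier a) (fence_order a) (antichain_of a s) \<longleftrightarrow>
    (Suc (h1 a s) < a \<and> 0 < x \<and> x \<le> Suc (h1 a s)) \<or>
    (Suc (h2 a s) < a \<and> valley s \<and> 2 * a \<le> x + Suc (h2 a s) \<and> x \<le> 2 * a) \<or>
    (Suc (h3 a s) < a \<and> valley s \<and> 2 * a \<le> x \<and> x \<le> 2 * a + Suc (h3 a s)) \<or>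
    (Suc (h4 a s) < a \<and> 4 * a \<le> x + Suc (h4 a s) \<and> x < 4 * a) \<or>
    (\<not> valley s \<and> x = 2 * a) \<or>
    (a \<in> antichain_of a s \<and> 0 < x \<and> x \<le> 2 * a) \<or>
    (3 * a \<in> antichain_of a s \<and> 2 * a \<le> x \<and> x < 4 * a)" (is "_ \<longleftrightarrow> ?rhs")
proof -
  have "x \<in> generated_ideal (fence_carrier a) (fence_order a) (antichain_of a s) \<longleftrightarrow>
    (\<exists>y. y \<in> antichain_of a s \<and> (x, y) \<in> fence_order a)"
    unfolding generated_ideal_def fence_order_def by blast
  also have "\<dots> \<longleftrightarrow>
    (Suc (h1 a s) < a \<and> (x, Suc (h1 a s)) \<in> fence_order a) \<or>
    (Suc (h2 a s) < a \<and> valley s \<and> (x, 2 * a - Suc (h2 a s)) \<in> fence_order a) \<or>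
    (Suc (h3 a s) < a \<and> valley s \<and> (x, 2 * a + Suc (h3 a s)) \<in> fence_order a) \<or>
    (Suc (h4 a s) < a \<and> (x, 4 * a - Suc (h4 a s)) \<in> fence_order a) \<or>
    (\<not> valley s \<and> (x, 2 * a) \<in> fence_order a) \<or>
    (a \<in> antichain_of a s \<and> (x, a) \<in> fence_order a) \<or>
    (3 * a \<in> antichain_of a s \<and> (x, 3 * a) \<in> fence_order a)"
    unfolding antichain_of_arms(6,7)[OF a2 s] unfolding antichain_of_def by blast
  also have "\<dots> \<longleftrightarrow> ?rhs"
  proof -
    have "Suc (h1 a s) < a \<Longrightarrow> (x, Suc (h1 a s)) \<in> fence_order a \<longleftrightarrow> 0 < x \<and> x \<le> Suc (h1 a s)"
      by (subst fence_order_arms) auto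
    moreover have "Suc (h2 a s) < a \<Longrightarrow> (x, 2 * a - Suc (h2 a s)) \<in> fence_order a
        \<longleftrightarrow> 2 * a \<le> x + Suc (h2 a s) \<and> x \<le> 2 * a"
      by (subst fence_order_arms) auto
    moreover have "Suc (h3 a s) < a \<Longrightarrow> (x, 2 * a + Suc (h3 a s)) \<in> fence_order a
        \<longleftrightarrow> 2 * a \<le> x \<and> x \<le> 2 * a + Suc (h3 a s)"
      by (subst fence_order_arms) auto
    moreover have "Suc (h4 a s) < a \<Longrightarrow> (x, 4 * a - Suc (h4 a s)) \<in> fence_order a
        \<longleftrightarrow> 4 * a \<le> x + Suc (h4 a s) \<and> x < 4 * a"
      by (subst fence_order_arms(4)) auto
    ultimately show ?thesis unfolding fence_order_arms(5-7) by argo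
  qed
  finally show ?thesis .
qed

lemma generated_ideal_arms:
  assumes s: "valid_state a s"
  defines "A \<equiv> antichain_of a s"
  defines "I \<equiv> generated_ideal (fence_carrier a) (fence_order a) A"
  shows "0 < x \<Longrightarrow> x < a \<Longrightarrow> x \<in> I \<longleftrightarrow> a \<in> A \<or> Suc (h1 a s) < a \<and> x \<le> Suc (h1 a s)"
    and "a < x \<Longrightarrow> x < 2 * a \<Longrightarrow> x \<in> I \<longleftrightarrow> a \<in> A \<or> valley s \<and> Suc (h2 a s) < a \<and> 2 * a \<le> x + Suc (h2 a s)"
    and "2 * a < x \<Longrightarrow> x < 3 * a \<Longrightarrow> x \<in> I \<longleftrightarrow> 3 * a \<in> A \<or> valley s \<and> Suc (h3 a s) < a \<and> x \<le> 2 * a + Suc (h3 a s)"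
    and "3 * a < x \<Longrightarrow> x < 4 * a \<Longrightarrow> x \<in> I \<longleftrightarrow> 3 * a \<in> A \<or> Suc (h4 a s) < a \<and> 4 * a \<le> x + Suc (h4 a s)"
    and "a \<in> I \<longleftrightarrow> a \<in> A"
    and "2 * a \<in> I \<longleftrightarrow> a \<in> A \<or> 3 * a \<in> A \<or> \<not> valley s \<or> Suc (h2 a s) < a \<or> Suc (h3 a s) < a"
    and "3 * a \<in> I \<longleftrightarrow> 3 * a \<in> A"
  unfolding I_def A_def generated_ideal_antichain_of_iff[OF s]
  using a2 by - (rule iffI; (elim disjE conjE)?; auto)+

text \<open>The cases of \<open>step\<close> amount to one rule per arm. A new peak leaves both arms
  below it at \<open>a - 1\<close>, where they already stood, and a missing valley leaves the middle
  arms at 0; these are the pauses. Otherwise a counter advances or wraps.\<close>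

lemma step_heights:
  assumes s: "valid_state a s"
  defines "A \<equiv> antichain_of a s"
  shows "peak1 (step a s) \<longleftrightarrow> a \<in> A" "peak2 (step a s) \<longleftrightarrow> 3 * a \<in> A"
   "valley (step a s) \<longleftrightarrow> a \<in> A \<or> 3 * a \<in> A \<or> \<not> valley s \<or> Suc (h2 a s) < a \<or> Suc (h3 a s) < a"
   "h1 a (step a s) = (if a \<in> A then a - 1 else if Suc (h1 a s) < a then Suc (h1 a s) else 0)"
   "h4 a (step a s) = (if 3 * a \<in> A then a - 1 else if Suc (h4 a s) < a then Suc (h4 a s) else 0)"
   "h2 a (step a s) = (if a \<in> A then a - 1 else if valley s \<and> Suc (h2 a s) < a then Suc (h2 a s) else 0)"
   "h3 a (step a s) = (if 3 * a \<in> A then a - 1 else if valley s \<and> Suc (h3 a s) < a then Suc (h3 a s) else 0)"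
  using s a2 unfolding A_def antichain_of_arms[OF a2 s]
  by (cases s; auto simp: nx_eq)+

text \<open>The antichain attached to a state generates the ideal of the next state, not of the
  state itself. Together with the description of the minimal elements, this makes both forms of
  rowmotion correspond to \<open>step\<close>.\<close>

lemma generated_ideal_antichain_of:
  assumes s: "valid_state a s"
  shows "generated_ideal (fence_carrier a) (fence_order a) (antichain_of a s) = ideal_of a (step a s)"
    (is "?I = ?J")
proof (rule set_eqI)
  fix x
  note [simp] = ideal_of_arms[OF a2 valid_state_step[OF s]] generated_ideal_arms[OF s] step_heights[OF s]
  show "x \<in> ?I \<longleftrightarrow> x \<in> ?J"
  proof (cases "x \<in> fence_carrier a")
    case False
    then have "x \<notin> ?I" by (simp add: generated_ideal_def)
    moreover have "x \<notin> ?J" using False ideal_of_in[OF a2 valid_state_step[OF s]]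
      by (auto simp: ideals_def)
    ultimately show ?thesis by simp
  next
    case True
    from fence_cases[OF a2 this] show ?thesis by cases auto
  qed
qed

end

text \<open>Points need to differ only when both guards hold: the formulas in
  \<open>antichain_of\<close> can coincide when a guard fails, as the successor of a full first arm
  is the peak.\<close>

lemma card_guarded_points:
  assumes "sorted_wrt (\<lambda>(p, P) (q, Q). P \<longrightarrow> Q \<longrightarrow> p \<noteq> q) ps"
  shows "card {x. \<exists>(p, P) \<in> set ps. x = p \<and> P} = (\<Sum>(p, P)\<leftarrow>ps. of_bool P)"
  using assms
proof (induction ps)
  case (Cons pP ps)
  obtain p P where pP: "pP = (p, P)" by force
  have fin: "finite {x. \<exists>(p, P) \<in> set ps. x = p \<and> P}"
    by (rule finite_subset[of _ "fst ` set ps"]) force+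
  have "{x. \<exists>(p, P) \<in> set (pP # ps). x = p \<and> P} =
      (if P then insert p {x. \<exists>(p, P) \<in> set ps. x = p \<and> P} else {x. \<exists>(p, P) \<in> set ps. x = p \<and> P})"
    by (auto simp: pP)
  moreover have "P \<Longrightarrow> p \<notin> {x. \<exists>(p, P) \<in> set ps. x = p \<and> P}"
    using Cons.prems by (auto simp: pP)
  ultimately show ?case using Cons fin by (simp add: pP)
qed simp

lemma fence_carrier_finite: "finite (fence_carrier a)"
  by (simp add: fence_carrier_def)

section \<open>States in bijection with ideals and antichains, and their cardinalities\<close>

context
  fixes a :: nat
  assumes a2: "2 \<le> a"
begin

lemma ideal_of_surj:
  assumes I: "I \<in> ideals (fence_carrier a) (fence_order a)"
  obtains s where "valid_state a s" "ideal_of a s = I"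
proof -
  have down: "x \<in> I" if "y \<in> I" "(x, y) \<in> fence_order a" for x y
    using I that unfolding ideals_def fence_order_def by blast
  have a0: "0 < a" using a2 by simp
  note fo = fence_order_iff[OF a2]
  have "\<And>x. 0 < x \<Longrightarrow> Suc x < a \<Longrightarrow> Suc x \<in> I \<Longrightarrow> x \<in> I"
    by (erule down) (auto simp: fo)
  from initial_segment[of a "\<lambda>x. x \<in> I", OF this a0]
  obtain i where i: "i < a" "\<And>x. 0 < x \<Longrightarrow> x < a \<Longrightarrow> x \<in> I \<longleftrightarrow> x \<le> i" by blast
  \<comment> \<open>In the second and fourth arm the indices decrease upwards, so \<open>x\<close>
    is subtracted in order to count from the bottom again.\<close>
  have "\<And>x. 0 < x \<Longrightarrow> Suc x < a \<Longrightarrow> 2 * a - Suc x \<in> I \<Longrightarrow> 2 * a - x \<in> I"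
    by (erule down) (auto simp: fo)
  from initial_segment[of a "\<lambda>x. 2 * a - x \<in> I", OF this a0]
  obtain j where j: "j < a" "\<And>x. 0 < x \<Longrightarrow> x < a \<Longrightarrow> 2 * a - x \<in> I \<longleftrightarrow> x \<le> j" by blast
  have "\<And>x. 0 < x \<Longrightarrow> Suc x < a \<Longrightarrow> 2 * a + Suc x \<in> I \<Longrightarrow> 2 * a + x \<in> I"
    by (erule down) (auto simp: fo)
  from initial_segment[of a "\<lambda>x. 2 * a + x \<in> I", OF this a0]
  obtain k where k: "k < a" "\<And>x. 0 < x \<Longrightarrow> x < a \<Longrightarrow> 2 * a + x \<in> I \<longleftrightarrow> x \<le> k" by blast
  have "\<And>x. 0 < x \<Longrightarrow> Suc x < a \<Longrightarrow> 4 * a - Suc x \<in> I \<Longrightarrow> 4 * a - x \<in> I"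
    by (erule down) (auto simp: fo)
  from initial_segment[of a "\<lambda>x. 4 * a - x \<in> I", OF this a0]
  obtain l where l: "l < a" "\<And>x. 0 < x \<Longrightarrow> x < a \<Longrightarrow> 4 * a - x \<in> I \<longleftrightarrow> x \<le> l" by blast
  \<comment> \<open>The three turning points select the constructor. A peak in \<open>I\<close>
    forces the valley and both arms below it into \<open>I\<close>, so the counters of these arms
    are dropped.\<close>
  define s where "s = (if 2 * a \<notin> I then E i l else if a \<in> I then if 3 * a \<in> I then PP else LP k l
     else if 3 * a \<in> I then RP i j else N i j k l)"
  have s: "valid_state a s" using i(1) j(1) k(1) l(1) by (simp add: s_def)
  have J: "2 * a - x \<in> I \<longleftrightarrow> x \<le> j" "4 * a - x \<in> I \<longleftrightarrow> x \<le> l" if "0 < x" "x < a" for x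
    using j l that by auto
  have peak: "x \<in> I" if "a \<in> I" "0 < x" "x \<le> 2 * a" for x
    using down[OF that(1), of x] that by (simp add: fence_order_arms[OF a2])
  have peak': "x \<in> I" if "3 * a \<in> I" "2 * a \<le> x" "x < 4 * a" for x
    using down[OF that(1), of x] that by (simp add: fence_order_arms[OF a2])
  have bot: "x \<notin> I" if "2 * a \<notin> I" "a \<le> x" "x \<le> 3 * a" for x
    using down[of x "2 * a"] that a2 unfolding fo by (cases "x \<le> 2 * a") auto
  have "x \<in> I \<longleftrightarrow> x \<in> ideal_of a s" if "x \<in> fence_carrier a" for x
    using fence_cases[OF a2 that]
  proof cases
    case 1
    then show ?thesis unfolding ideal_of_arms(1)[OF a2 s 1]
      using i(2)[OF 1] peak[of x] by (auto simp: s_def)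
  next
    case 2
    then show ?thesis unfolding ideal_of_arms(2)[OF a2 s 2]
      using j(2)[of "2 * a - x"] peak[of x] bot[of x] by (auto simp: s_def)
  next
    case 3
    then show ?thesis unfolding ideal_of_arms(3)[OF a2 s 3]
      using k(2)[of "x - 2 * a"] peak'[of x] bot[of x] by (auto simp: s_def)
  next
    case 4
    then show ?thesis unfolding ideal_of_arms(4)[OF a2 s 4]
      using l(2)[of "4 * a - x"] peak'[of x] by (auto simp: s_def)
  next
    case 5
    show ?thesis unfolding 5 ideal_of_arms(6)[OF a2 s] using bot[of a] by (auto simp: s_def)
  next
    case 6
    show ?thesis unfolding 6 ideal_of_arms(5)[OF a2 s] by (auto simp: s_def)
  next
    case 7
    show ?thesis unfolding 7 ideal_of_arms(7)[OF a2 s] using bot[of "3 * a"] by (auto simp: s_def)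
  qed
  moreover have "I \<subseteq> fence_carrier a" "ideal_of a s \<subseteq> fence_carrier a"
    using I ideal_of_in[OF a2 s] by (auto simp: ideals_def)
  ultimately have "ideal_of a s = I" by blast
  with s that show ?thesis by blast
qed

lemma state_eqI:
  assumes "valid_state a s" "valid_state a t"
    and "valley s = valley t" "peak1 s = peak1 t" "peak2 s = peak2 t"
      "h1 a s = h1 a t" "h2 a s = h2 a t" "h3 a s = h3 a t" "h4 a s = h4 a t"
  shows "s = t"
  using assms by (cases s; cases t; simp)

lemma inj_on_ideal_of: "inj_on (ideal_of a) {s. valid_state a s}"
proof (rule inj_onI, unfold mem_Collect_eq)
  fix s t assume s: "valid_state a s" and t: "valid_state a t" and eq: "ideal_of a s = ideal_of a t"
  note S = ideal_of_arms[OF a2 s, unfolded eq] and T = ideal_of_arms[OF a2 t]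
  note hs = heights[OF a2 s] and ht = heights[OF a2 t]
  have v: "valley s = valley t" "peak1 s = peak1 t" "peak2 s = peak2 t"
    using S(5-7) T(5-7) by auto
  \<comment> \<open>Evaluating the equivalence at \<open>m\<close> and at \<open>n\<close> compares
    the two; the value 0 lies outside the tested range and is treated apart.\<close>
  have le: "m = n" if "m < a" "n < a" "\<And>x. 0 < x \<Longrightarrow> x < a \<Longrightarrow> x \<le> m \<longleftrightarrow> x \<le> n" for m n :: nat
    using that(3)[of m] that(3)[of n] that(1,2) by (cases "m = 0"; cases "n = 0") auto
  have "h1 a s = h1 a t" using S(1) T(1) hs ht by (intro le) auto
  moreover have "h4 a s = h4 a t"
  proof (rule le)
    fix x assume "0 < x" "x < a"
    then have b: "3 * a < 4 * a - x" "4 * a - x < 4 * a" "4 * a \<le> 4 * a - x + n \<longleftrightarrow> x \<le> n" for n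
      by auto
    show "x \<le> h4 a s \<longleftrightarrow> x \<le> h4 a t"
      using S(4)[OF b(1,2)] T(4)[OF b(1,2)] unfolding b(3) by blast
  qed (use hs ht in auto)
  moreover have "h2 a s = h2 a t \<and> h3 a s = h3 a t"
  proof (cases "valley s")
    case True
    have "h2 a s = h2 a t"
    proof (rule le)
      fix x assume "0 < x" "x < a"
      then have b: "a < 2 * a - x" "2 * a - x < 2 * a" "2 * a \<le> 2 * a - x + n \<longleftrightarrow> x \<le> n" for n
        by auto
      show "x \<le> h2 a s \<longleftrightarrow> x \<le> h2 a t"
        using S(2)[OF b(1,2)] T(2)[OF b(1,2)] True v(1) unfolding b(3) by blast
    qed (use hs ht in auto)
    moreover have "h3 a s = h3 a t"
    proof (rule le)
      fix x assume "0 < x" "x < a"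
      then have b: "2 * a < 2 * a + x" "2 * a + x < 3 * a" by auto
      show "x \<le> h3 a s \<longleftrightarrow> x \<le> h3 a t"
        using S(3)[OF b] T(3)[OF b] True v(1) by simp
    qed (use hs ht in auto)
    ultimately show ?thesis ..
  next
    case False
    then show ?thesis using v hs ht by simp
  qed
  ultimately show "s = t" using state_eqI[OF s t] v by blast
qed

lemma ideal_rowmotion_ideal_of:
  "valid_state a s \<Longrightarrow> ideal_rowmotion (fence_carrier a) (fence_order a) (ideal_of a s) = ideal_of a (step a s)"
  by (simp add: ideal_rowmotion_def minimal_elements_ideal_of[OF a2] generated_ideal_antichain_of[OF a2])

lemma rowmotion_antichain_of:
  "valid_state a s \<Longrightarrow> rowmotion (fence_carrier a) (fence_order a) (antichain_of a s) = antichain_of a (step a s)"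
  by (simp add: rowmotion_def generated_ideal_antichain_of[OF a2]
      minimal_elements_ideal_of[OF a2 valid_state_step[OF a2]])

text \<open>Ideal rowmotion is a bijection and corresponds to \<open>step\<close> under
  \<open>ideal_of\<close>, so injectivity is inherited without a case analysis on states.\<close>

lemma inj_on_step: "inj_on (step a) {s. valid_state a s}"
proof (rule inj_onI, unfold mem_Collect_eq)
  fix s t assume s: "valid_state a s" and t: "valid_state a t" and eq: "step a s = step a t"
  have "ideal_of a s = ideal_of a t"
    using bij_betw_imp_inj_on[OF bij_betw_ideal_rowmotion[OF fence_carrier_finite partial_order_on_fence]]
      ideal_of_in[OF a2] s t eq ideal_rowmotion_ideal_of
    by (metis inj_onD)
  then show "s = t" using inj_on_ideal_of s t by (auto dest: inj_onD)
qed

text \<open>Equal antichains generate equal ideals, which belong to the successor states;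
  injectivity of \<open>ideal_of\<close> and of \<open>step\<close> leads back to the states
  themselves.\<close>

lemma inj_on_antichain_of: "inj_on (antichain_of a) {s. valid_state a s}"
proof (rule inj_onI, unfold mem_Collect_eq)
  fix s t assume s: "valid_state a s" and t: "valid_state a t" and "antichain_of a s = antichain_of a t"
  then have "ideal_of a (step a s) = ideal_of a (step a t)"
    by (simp flip: generated_ideal_antichain_of[OF a2])
  then have "step a s = step a t"
    by (rule inj_onD[OF inj_on_ideal_of]) (use s t valid_state_step[OF a2] in auto)
  then show "s = t"
    by (rule inj_onD[OF inj_on_step]) (use s t in auto)
qed

lemma antichain_of_image: "antichain_of a ` {s. valid_state a s} = antichains (fence_carrier a) (fence_order a)"
proof
  show "antichain_of a ` {s. valid_state a s} \<subseteq> antichains (fence_carrier a) (fence_order a)"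
  proof
    fix A assume "A \<in> antichain_of a ` {s. valid_state a s}"
    then obtain s where s: "valid_state a s" "A = antichain_of a s" by blast
    then show "A \<in> antichains (fence_carrier a) (fence_order a)"
      unfolding s(2) minimal_elements_ideal_of[OF a2 s(1), symmetric]
      by (auto simp: minimal_elements_def antichains_def)
  qed
  show "antichains (fence_carrier a) (fence_order a) \<subseteq> antichain_of a ` {s. valid_state a s}"
  proof
    fix A assume "A \<in> antichains (fence_carrier a) (fence_order a)"
    \<comment> \<open>Rowmotion is onto, so \<open>A\<close> consists of the minimal elements
      outside some ideal, and that ideal belongs to a state.\<close>
    then obtain B where B: "A = rowmotion (fence_carrier a) (fence_order a) B"
      using bij_betw_rowmotion[OF fence_carrier_finite partial_order_on_fence, of a]
      unfolding bij_betw_def by blast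
    have "generated_ideal (fence_carrier a) (fence_order a) B \<in> ideals (fence_carrier a) (fence_order a)"
      using partial_order_onD(2)[OF partial_order_on_fence[of a]]
      unfolding generated_ideal_def ideals_def trans_def by blast
    then obtain s where "valid_state a s" "ideal_of a s = generated_ideal (fence_carrier a) (fence_order a) B"
      using ideal_of_surj by blast
    then show "A \<in> antichain_of a ` {s. valid_state a s}"
      using minimal_elements_ideal_of[OF a2, of s] B unfolding rowmotion_def by auto
  qed
qed

lemma card_ideal_of:
  "i < a \<Longrightarrow> j < a \<Longrightarrow> k < a \<Longrightarrow> l < a \<Longrightarrow> card (ideal_of a (N i j k l)) = Suc (i + j + k + l)"
  "k < a \<Longrightarrow> l < a \<Longrightarrow> card (ideal_of a (LP k l)) = 2 * a + k + l"
  "i < a \<Longrightarrow> j < a \<Longrightarrow> card (ideal_of a (RP i j)) = 2 * a + i + j"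
  "card (ideal_of a PP) = 4 * a - 1"
  "i < a \<Longrightarrow> l < a \<Longrightarrow> card (ideal_of a (E i l)) = i + l"
proof -
  assume b: "i < a" "j < a" "k < a" "l < a"
  have "({1..i} \<union> {2 * a - j..2 * a + k}) \<inter> {4 * a - l..4 * a - 1} = {}"
    "{1..i} \<inter> {2 * a - j..2 * a + k} = {}"
    using b by auto
  then show "card (ideal_of a (N i j k l)) = Suc (i + j + k + l)"
    using b by (simp add: card_Un_disjoint)
qed (auto simp: card_Un_disjoint)

lemma card_antichain_of:
  assumes s: "valid_state a s"
  shows "card (antichain_of a s) = of_bool (Suc (h1 a s) < a) + of_bool (Suc (h2 a s) < a \<and> valley s) +
    of_bool (Suc (h3 a s) < a \<and> valley s) + of_bool (Suc (h4 a s) < a) + of_bool (\<not> valley s) +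
    of_bool (Suc (h1 a s) = a \<and> Suc (h2 a s) = a \<and> \<not> peak1 s) +
    of_bool (Suc (h3 a s) = a \<and> Suc (h4 a s) = a \<and> \<not> peak2 s)"
proof -
  define ps where "ps = [(Suc (h1 a s), Suc (h1 a s) < a), (2 * a - Suc (h2 a s), Suc (h2 a s) < a \<and> valley s),
    (2 * a + Suc (h3 a s), Suc (h3 a s) < a \<and> valley s), (4 * a - Suc (h4 a s), Suc (h4 a s) < a),
    (2 * a, \<not> valley s), (a, Suc (h1 a s) = a \<and> Suc (h2 a s) = a \<and> \<not> peak1 s),
    (3 * a, Suc (h3 a s) = a \<and> Suc (h4 a s) = a \<and> \<not> peak2 s)]"
  have "antichain_of a s = {x. \<exists>(p, P) \<in> set ps. x = p \<and> P}"
    by (simp only: antichain_of_def ps_def list.set bex_simps prod.case simp_thms)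
  moreover have "sorted_wrt (\<lambda>(p, P) (q, Q). P \<longrightarrow> Q \<longrightarrow> p \<noteq> q) ps"
    unfolding ps_def sorted_wrt.simps list.set ball_simps prod.case simp_thms using a2
    by (intro conjI impI notI; (elim conjE)?; linarith | blast)
  ultimately have "card (antichain_of a s) = (\<Sum>(p, P)\<leftarrow>ps. of_bool P)"
    by (simp only: card_guarded_points)
  then show ?thesis
    by (simp only: ps_def list.map sum_list.Cons sum_list.Nil prod.case add.assoc add_0_right)
qed

end

section \<open>Paths and orbits of states\<close>

text \<open>\<open>X\<close> collects the points visited before the arrival at \<open>y\<close>. The
  number of steps is hidden and repetitions are allowed, so paths compose by plain unions;
  distinctness is shown only where the sets are counted.\<close>

definition path :: "('a \<Rightarrow> 'a) \<Rightarrow> 'a \<Rightarrow> 'a set \<Rightarrow> 'a \<Rightarrow> bool" where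
  "path f x X y \<longleftrightarrow> (\<exists>n. (f ^^ n) x = y \<and> X = (\<lambda>i. (f ^^ i) x) ` {..<n})"

lemma path_seq:
  assumes "\<And>t. t < n \<Longrightarrow> f (s t) = s (Suc t)"
  shows "path f (s 0) (s ` {..<n}) (s n)"
proof -
  have "(f ^^ t) (s 0) = s t" if "t \<le> n" for t
    using that by (induction t) (auto simp: assms)
  then show ?thesis unfolding path_def by (intro exI[of _ n]) auto
qed

lemma path_empty: "path f x {} x"
  unfolding path_def by (intro exI[of _ 0]) auto

lemma path_step: "f x = y \<Longrightarrow> path f x {x} y"
  unfolding path_def by (intro exI[of _ 1]) (auto simp: lessThan_Suc)

lemma path_Un:
  assumes "path f x X y" "path f y Y z"
  shows "path f x (X \<union> Y) z"
proof -
  obtain m n where m: "(f ^^ m) x = y" "X = (\<lambda>i. (f ^^ i) x) ` {..<m}"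
    and n: "(f ^^ n) y = z" "Y = (\<lambda>i. (f ^^ i) y) ` {..<n}"
    using assms unfolding path_def by blast
  have shift: "(f ^^ i) y = (f ^^ (i + m)) x" for i
    unfolding m(1)[symmetric] funpow_add by simp
  have "{..<n + m} = {..<m} \<union> (\<lambda>i. i + m) ` {..<n}"
    unfolding lessThan_atLeast0 image_add_atLeastLessThan' by auto
  then have "X \<union> Y = (\<lambda>i. (f ^^ i) x) ` {..<n + m}"
    unfolding m(2) n(2) shift by (auto simp: image_iff)
  then show ?thesis
    unfolding path_def using n(1) shift by metis
qed

lemma cyclic_on_path:
  assumes "path f x X x" "X \<noteq> {}"
  shows "cyclic_on f X"
proof -
  obtain n where n: "(f ^^ n) x = x" "X = (\<lambda>i. (f ^^ i) x) ` {..<n}"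
    using assms(1) unfolding path_def by blast
  with assms(2) have "0 < n" by auto
  then have "orbit f x = X" "x \<in> X"
    using n orbit_altdef_bounded[of n f x] by (force simp: image_iff)+
  then show ?thesis by (auto intro: cyclic_on_singleI)
qed

lemma path_image:
  assumes "path f x X y" "\<And>s. g (h s) = h (f s)"
  shows "path g (h x) (h ` X) (h y)"
proof -
  obtain n where n: "(f ^^ n) x = y" "X = (\<lambda>i. (f ^^ i) x) ` {..<n}"
    using assms(1) unfolding path_def by blast
  have "(g ^^ i) (h x) = h ((f ^^ i) x)" for i by (induction i) (auto simp: assms(2))
  then show ?thesis unfolding path_def using n by (intro exI[of _ n]) (auto simp: image_image)
qed

text \<open>Chinese remainder theorem for the coprime periods \<open>a\<close> and
  \<open>a + 1\<close>, by injectivity and counting. It will show that a drifting pair with period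
  \<open>a + 1\<close> meets every value of a counter with period \<open>a\<close>.\<close>

lemma mod_pairs:
  fixes a :: nat
  assumes "0 < a"
  shows "(\<lambda>t. (t mod Suc a, t mod a)) ` {..<a * Suc a} = {..a} \<times> {..<a}"
proof (rule card_subset_eq)
  have "inj_on (\<lambda>t. (t mod Suc a, t mod a)) {..<a * Suc a}"
  proof (rule linorder_inj_onI')
    fix s t assume st: "s \<in> {..<a * Suc a}" "t \<in> {..<a * Suc a}" "s < t"
    show "(s mod Suc a, s mod a) \<noteq> (t mod Suc a, t mod a)"
    proof
      assume "(s mod Suc a, s mod a) = (t mod Suc a, t mod a)"
      then have "Suc a dvd t - s" "a dvd t - s"
        using mod_eq_dvd_iff_nat[of s t] st(3) by (metis Pair_inject less_imp_le)+
      then have "a * Suc a dvd t - s" by (intro divides_mult) auto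
      then show False using st by (auto dest: dvd_imp_le)
    qed
  qed
  then show "card ((\<lambda>t. (t mod Suc a, t mod a)) ` {..<a * Suc a}) = card ({..a} \<times> {..<a})"
    by (simp add: card_image)
qed (use assms in \<open>auto simp: less_Suc_eq_le[symmetric]\<close>)

text \<open>Two counters of equal period with a nonzero offset never meet; this is what rules out
  pauses.\<close>

lemma add_mod_neq:
  fixes a :: nat
  assumes "0 < c" "c < a"
  shows "(t + c) mod a \<noteq> t mod a"
proof
  assume "(t + c) mod a = t mod a"
  then have "a dvd c" using mod_eq_dvd_iff_nat[of t "t + c" a] by simp
  then show False using assms by (auto dest: dvd_imp_le)
qed

lemma nx_mod: "nx a (x mod a) = Suc x mod a"
  by (simp add: nx_def mod_Suc_eq)

text \<open>On states, this is the reflection of the fence that sends the index \<open>i\<close> to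
  \<open>4 * a - i\<close>.\<close>

fun mirror :: "state \<Rightarrow> state" where
  "mirror (N i j k l) = N l k j i"
| "mirror (LP k l) = RP l k"
| "mirror (RP i j) = LP j i"
| "mirror PP = PP"
| "mirror (E i l) = E l i"

lemma mirror_mirror: "mirror (mirror s) = s"
  by (cases s) auto

lemma inj_mirror: "inj mirror"
  by (rule inj_on_inverseI[where g = mirror]) (rule mirror_mirror)

text \<open>The fence is symmetric. In \<open>step\<close> the order of the two peak tests is
  immaterial because their common case \<open>PP\<close> is split off first, and the middle test is
  symmetric by itself.\<close>

lemma step_mirror: "step a (mirror s) = mirror (step a s)"
proof (cases s)
  case (N i j k l)
  then show ?thesis
    by (cases "i = a - 1 \<and> j = a - 1"; cases "k = a - 1 \<and> l = a - 1"; cases "j = a - 1 \<and> k = a - 1")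
      (simp_all add: conj_commute)
qed simp_all

lemma valid_state_mirror: "valid_state a (mirror s) \<longleftrightarrow> valid_state a s"
  by (cases s) auto

text \<open>
  The value \<open>a\<close> of a synchronised counter stands for the pause: the presence of a peak in
  \<open>paired\<close> and \<open>semi\<close>, the absence of the valley in \<open>inner\<close>.
\<close>

definition free_orbit :: "nat \<Rightarrow> nat \<Rightarrow> nat \<Rightarrow> nat \<Rightarrow> state set" where
  "free_orbit a \<alpha> \<beta> \<gamma> =
     (\<lambda>t. N ((t + \<beta> + \<alpha>) mod a) ((t + \<beta>) mod a) (t mod a) ((t + \<gamma>) mod a)) ` {..<a}"

definition paired :: "nat \<Rightarrow> nat \<Rightarrow> nat \<Rightarrow> state" where
  "paired a p q = (if p = a then if q = a then PP else LP q q else if q = a then RP p p else N p p q q)"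

text \<open>\<open>c\<close> is the lead of the left pair over the right one, modulo
  \<open>a + 1\<close>.\<close>

definition paired_orbit :: "nat \<Rightarrow> nat \<Rightarrow> state set" where
  "paired_orbit a c = (\<lambda>t. paired a ((t + c) mod Suc a) (t mod Suc a)) ` {..<Suc a}"

definition semi :: "nat \<Rightarrow> nat \<Rightarrow> nat \<Rightarrow> nat \<Rightarrow> state" where
  "semi a c p k = (if p = a then LP k ((k + c) mod a) else N p p k ((k + c) mod a))"

definition semi_phase :: "nat \<Rightarrow> nat \<Rightarrow> state set" where
  "semi_phase a c = (\<lambda>(p, k). semi a c p k) ` ({..a} \<times> {..<a})"

definition inner :: "nat \<Rightarrow> nat \<Rightarrow> nat \<Rightarrow> nat \<Rightarrow> state" where
  "inner a i l q = (if q = a then E i l else N (Suc (i + q) mod a) q q (Suc (l + q) mod a))"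

text \<open>Lap \<open>y\<close> starts at \<open>E (i + y) (l + y)\<close>, the value
  \<open>a\<close> of \<open>q\<close>; during it the outer counters lead the middle ones by
  \<open>Suc (i + y)\<close> and \<open>Suc (l + y)\<close>.\<close>

definition inner_phase :: "nat \<Rightarrow> nat \<Rightarrow> nat \<Rightarrow> nat \<Rightarrow> state set" where
  "inner_phase a i l n = (\<lambda>(y, q). inner a (i + y) (l + y) q) ` ({..<n} \<times> {..a})"

text \<open>The isolated last state is a pause of the middle pair that no full lap follows.\<close>

definition half_orbit :: "nat \<Rightarrow> nat \<Rightarrow> state set" where
  "half_orbit a c = semi_phase a c \<union> (inner_phase a 0 c (a - 1 - c) \<union> {E (a - 1 - c) (a - 1)})"

text \<open>The first half leads to \<open>N (a - c) 0 0 0\<close>, the reflection of the start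
  \<open>N 0 0 0 (a - c)\<close> of the half for \<open>a - c\<close>; hence the reflected second
  half fits on.\<close>

definition giant_orbit :: "nat \<Rightarrow> nat \<Rightarrow> state set" where
  "giant_orbit a c = half_orbit a c \<union> mirror ` half_orbit a (a - c)"

text \<open>This is the middle drift for equal outer counters, closed up by one run in which all
  four counters agree, from 0 until both peaks are present.\<close>

definition long_orbit :: "nat \<Rightarrow> state set" where
  "long_orbit a = inner_phase a 0 0 (a - 1) \<union> ({E (a - 1) (a - 1)} \<union> (\<lambda>p. paired a p p) ` {..a})"

section \<open>The families of states are cycles of \<open>step\<close>\<close>

context
  fixes a :: nat
  assumes a2: "2 \<le> a"
begin

text \<open>Nonzero offsets keep neighbours apart, so no counter pauses and all offsets
  persist.\<close>

lemma cyclic_on_free_orbit: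
  assumes "\<alpha> \<in> {1..<a}" "\<beta> \<in> {1..<a}" "\<gamma> \<in> {1..<a}"
  shows "cyclic_on (step a) (free_orbit a \<alpha> \<beta> \<gamma>)"
proof (rule cyclic_on_path)
  let ?s = "\<lambda>t. N ((t + \<beta> + \<alpha>) mod a) ((t + \<beta>) mod a) (t mod a) ((t + \<gamma>) mod a)"
  have "step a (?s t) = ?s (Suc t)" for t
    using add_mod_neq[of \<alpha> a "t + \<beta>"] add_mod_neq[of \<beta> a t] add_mod_neq[of \<gamma> a t] assms
    by (auto simp: nx_mod)
  then have "path (step a) (?s 0) (?s ` {..<a}) (?s a)" by (rule path_seq)
  moreover have "?s 0 = ?s a" by (simp add: add.assoc)
  ultimately show "path (step a) (?s 0) (free_orbit a \<alpha> \<beta> \<gamma>) (?s 0)"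
    unfolding free_orbit_def by metis
qed (use a2 in \<open>simp add: free_orbit_def lessThan_empty_iff\<close>)

text \<open>With its pause included, a pair is a single counter of period \<open>a + 1\<close>. For
  unequal values the middle arms are both full only while one peak is present and the other is just
  being added, and then they do not pause. Equality at \<open>a\<close> is a true exception, as
  \<open>PP\<close> is followed by \<open>E 0 0\<close>.\<close>

lemma step_paired:
  assumes "p \<le> a" "q \<le> a" "p \<noteq> q"
  shows "step a (paired a p q) = paired a (Suc p mod Suc a) (Suc q mod Suc a)"
proof -
  have "Suc x mod Suc a = (if x = a then 0 else Suc x)" if "x \<le> a" for x
    using that by simp
  moreover have "x = a - Suc 0 \<longleftrightarrow> Suc x = a" for x
    using a2 by auto
  ultimately show ?thesis
    using assms a2 by (cases "p = a"; cases "q = a"; cases "Suc p = a"; cases "Suc q = a")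
      (simp_all add: paired_def nx_def)
qed

lemma step_paired_diag: "p < a \<Longrightarrow> step a (paired a p p) = paired a (Suc p) (Suc p)"
  using a2 by (auto simp: paired_def nx_eq[OF a2])

lemma cyclic_on_paired_orbit:
  assumes "c \<in> {1..a}"
  shows "cyclic_on (step a) (paired_orbit a c)"
proof (rule cyclic_on_path)
  let ?s = "\<lambda>t. paired a ((t + c) mod Suc a) (t mod Suc a)"
  have "step a (?s t) = ?s (Suc t)" for t
    using add_mod_neq[of c "Suc a" t] assms
    by (subst step_paired) (auto simp: less_Suc_eq_le[symmetric] mod_Suc_eq)
  then have "path (step a) (?s 0) (?s ` {..<Suc a}) (?s (Suc a))" by (rule path_seq)
  moreover have "?s 0 = ?s (Suc a)" using mod_add_self1[of "Suc a" c] by simp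
  ultimately show "path (step a) (?s 0) (paired_orbit a c) (?s 0)"
    unfolding paired_orbit_def by metis
qed (auto simp: paired_orbit_def)

text \<open>The excluded combination is the moment when the left peak is present and the third arm
  is full without the fourth: the valley disappears next and the middle pair takes over.\<close>

lemma step_semi:
  assumes "p \<le> a" "k < a" "0 < c" "c < a" "p \<noteq> a \<or> Suc k \<noteq> a"
  shows "step a (semi a c p k) = semi a c (Suc p mod Suc a) (Suc k mod a)"
proof -
  have "(k + c) mod a \<noteq> k" using add_mod_neq[of c a k] assms by simp
  moreover have "nx a ((k + c) mod a) = (Suc k mod a + c) mod a"
    by (simp add: nx_mod mod_simps)
  ultimately show ?thesis using assms a2 by (auto simp: semi_def nx_def)
qed

lemma path_semi_phase:
  assumes "0 < c" "c < a"
  shows "path (step a) (N 0 0 0 c) (semi_phase a c) (E 0 c)"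
proof -
  define n where "n = a * Suc a"
  \<comment> \<open>The pair runs modulo \<open>a + 1\<close> and the third counter modulo
    \<open>a\<close>. At time \<open>n\<close> the formula would return to its start, so the state
    reached there is set separately.\<close>
  define s where "s t = (if t = n then E 0 c else semi a c (t mod Suc a) (t mod a))" for t
  have "step a (s t) = s (Suc t)" if t: "t < n" for t
  proof (cases "Suc t = n")
    case False
    \<comment> \<open>Both counters at their last value make \<open>Suc t\<close> a common multiple
      of the coprime numbers \<open>a + 1\<close> and \<open>a\<close>, which happens first at
      \<open>n\<close>.\<close>
    have "\<not> (t mod Suc a = a \<and> Suc (t mod a) = a)"
    proof
      assume "t mod Suc a = a \<and> Suc (t mod a) = a"
      then have "Suc t mod Suc a = 0" "Suc t mod a = 0" by (auto simp: mod_Suc)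
      then have "n dvd Suc t" unfolding n_def by (intro divides_mult) auto
      with t False show False by (auto dest: dvd_imp_le)
    qed
    moreover have "t mod Suc a \<le> a" using mod_less_divisor[of "Suc a" t] by linarith
    ultimately show ?thesis using t False assms a2
      by (simp add: s_def step_semi mod_Suc_eq)
  next
    case True
    \<comment> \<open>The last time before \<open>n\<close> is written in two ways, one for each
      remainder.\<close>
    have t1: "t = (a - 1) * Suc a + a" and t2: "t = a * a + (a - 1)"
      using True a2 unfolding n_def by (cases a; simp)+
    have "t mod Suc a = a" unfolding t1 mod_mult_self3 by simp
    moreover have "t mod a = a - 1" unfolding t2 mod_mult_self3 using a2 by simp
    moreover have "nx a ((a - 1 + c) mod a) = c"
      using assms a2 by (simp add: nx_mod)
    ultimately show ?thesis using t True a2 assms add_mod_neq[of c a "a - 1"]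
      by (simp add: s_def semi_def)
  qed
  then have "path (step a) (s 0) (s ` {..<n}) (s n)" by (rule path_seq)
  moreover have "s ` {..<n} = semi_phase a c"
  proof -
    have "s ` {..<n} = (\<lambda>(p, k). semi a c p k) ` (\<lambda>t. (t mod Suc a, t mod a)) ` {..<n}"
      unfolding image_image by (rule image_cong) (auto simp: s_def)
    then show ?thesis unfolding n_def semi_phase_def using a2 by (subst (asm) mod_pairs) auto
  qed
  ultimately show ?thesis using a2 assms by (simp add: s_def n_def semi_def)
qed

text \<open>The middle pair needs \<open>a + 1\<close> steps for a lap and the outer counters only
  \<open>a\<close> for a turn, so they gain one. The bounds keep them away from the middle counters,
  and no peak intervenes.\<close>

lemma path_inner_lap:
  assumes "Suc i < a" "Suc l < a"
  shows "path (step a) (E i l) (inner a i l ` {..a}) (E (Suc i) (Suc l))"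
proof -
  \<comment> \<open>A lap begins with the pause, the value \<open>a\<close> of the parameter, and
    continues with 0 to \<open>a - 1\<close>. In this sequence the index \<open>a\<close> is
    therefore free for the first state of the next lap.\<close>
  define s where "s q = (if q = a then E (Suc i) (Suc l) else inner a i l q)" for q
  have "step a (s q) = s (Suc q)" if "q < a" for q
  proof (cases "Suc q = a")
    case True
    then have "Suc (i + q) mod a = i" "Suc (l + q) mod a = l"
      using assms by (metis add_Suc_right mod_add_self2 mod_less Suc_lessD)+
    then show ?thesis using True assms by (auto simp: s_def inner_def nx_def)
  next
    case False
    then have "nx a q = Suc q" using that by (simp add: nx_def)
    with False that show ?thesis by (auto simp: s_def inner_def nx_mod)
  qed
  then have "path (step a) (s 0) (s ` {..<a}) (s a)" by (rule path_seq)
  moreover have "step a (E i l) = s 0" using assms by (simp add: s_def inner_def nx_def)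
  ultimately have "path (step a) (E i l) ({E i l} \<union> s ` {..<a}) (E (Suc i) (Suc l))"
    using path_Un[OF path_step] by (metis s_def)
  moreover have "{E i l} \<union> s ` {..<a} = inner a i l ` {..a}"
    by (auto simp: s_def inner_def le_less image_iff)
  ultimately show ?thesis by simp
qed

lemma path_inner_phase:
  assumes "i + n < a" "l + n < a"
  shows "path (step a) (E i l) (inner_phase a i l n) (E (i + n) (l + n))"
  using assms
proof (induction n)
  case 0
  then show ?case using path_empty by (simp add: inner_phase_def)
next
  case (Suc n)
  have "inner_phase a i l (Suc n) = inner_phase a i l n \<union> inner a (i + n) (l + n) ` {..a}"
    unfolding inner_phase_def by (force simp: less_Suc_eq)
  with path_Un[OF Suc.IH path_inner_lap[of "i + n" "l + n"]] Suc.prems show ?case by simp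
qed

text \<open>After \<open>a - 1 - c\<close> laps the fourth counter stands at \<open>a - 1\<close>
  while the valley is absent; one more step wraps it to 0, level with the third counter.\<close>

lemma path_half_orbit:
  assumes "0 < c" "c < a"
  shows "path (step a) (N 0 0 0 c) (half_orbit a c) (N (a - c) 0 0 0)"
proof -
  have "step a (E (a - 1 - c) (a - 1)) = N (a - c) 0 0 0"
    using assms a2 by (simp add: nx_eq[OF a2] Suc_diff_Suc)
  then have "path (step a) (E (a - 1 - c) (a - 1)) {E (a - 1 - c) (a - 1)} (N (a - c) 0 0 0)"
    by (rule path_step)
  moreover have "path (step a) (E 0 c) (inner_phase a 0 c (a - 1 - c)) (E (a - 1 - c) (a - 1))"
    using path_inner_phase[of 0 "a - 1 - c" c] assms by simp
  ultimately show ?thesis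
    unfolding half_orbit_def by (intro path_Un[OF path_semi_phase[OF assms]] path_Un)
qed

lemma cyclic_on_giant_orbit:
  assumes "c \<in> {1..<a}"
  shows "cyclic_on (step a) (giant_orbit a c)"
proof (rule cyclic_on_path)
  have "path (step a) (N 0 0 0 (a - c)) (half_orbit a (a - c)) (N c 0 0 0)"
    using path_half_orbit[of "a - c"] assms by simp
  from path_image[OF this, of "step a" mirror]
  have "path (step a) (N (a - c) 0 0 0) (mirror ` half_orbit a (a - c)) (N 0 0 0 c)"
    by (simp add: step_mirror)
  with assms show "path (step a) (N 0 0 0 c) (giant_orbit a c) (N 0 0 0 c)"
    unfolding giant_orbit_def by (intro path_Un[OF path_half_orbit]) auto
qed (auto simp: giant_orbit_def half_orbit_def)

lemma cyclic_on_long_orbit: "cyclic_on (step a) (long_orbit a)"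
proof (rule cyclic_on_path)
  \<comment> \<open>The common run starts in \<open>N 0 0 0 0\<close>, reaches \<open>PP\<close> at
    the value \<open>a\<close> and leaves for \<open>E 0 0\<close>, where the middle drift
    begins.\<close>
  define s where "s p = (if p = Suc a then E 0 0 else paired a p p)" for p
  have "step a (s p) = s (Suc p)" if "p < Suc a" for p
    using that step_paired_diag[of p] by (cases "p = a") (auto simp: s_def paired_def)
  then have "path (step a) (s 0) (s ` {..<Suc a}) (s (Suc a))" by (rule path_seq)
  moreover have "s ` {..<Suc a} = (\<lambda>p. paired a p p) ` {..a}"
    by (rule image_cong) (auto simp: s_def)
  moreover have "step a (E (a - 1) (a - 1)) = s 0"
    using a2 by (simp add: s_def paired_def nx_eq[OF a2])
  ultimately have "path (step a) (E (a - 1) (a - 1))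
      ({E (a - 1) (a - 1)} \<union> (\<lambda>p. paired a p p) ` {..a}) (E 0 0)"
    using path_Un[OF path_step] by (metis s_def)
  with path_inner_phase[of 0 "a - 1" 0] a2 show "path (step a) (E 0 0) (long_orbit a) (E 0 0)"
    unfolding long_orbit_def by (intro path_Un[of "step a" "E 0 0" _ "E (a - 1) (a - 1)"]) auto
qed (auto simp: long_orbit_def)

end

section \<open>Every state lies on one of the orbits\<close>

lemma inj_on_mod_shift:
  fixes n :: nat
  shows "inj_on (\<lambda>x. (x + c) mod n) {..<n}"
proof (rule linorder_inj_onI')
  fix x y assume xy: "x \<in> {..<n}" "y \<in> {..<n}" "x < y"
  then have "(x + c + (y - x)) mod n \<noteq> (x + c) mod n" by (intro add_mod_neq) auto
  moreover have "x + c + (y - x) = y + c" using xy by simp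
  ultimately show "(x + c) mod n \<noteq> (y + c) mod n" by metis
qed

text \<open>A shift permutes the residues. Sums over a full turn of a counter thus forget its
  offset, which makes the orbit sums independent of the parameters.\<close>

lemma sum_mod_shift:
  fixes n :: nat
  shows "(\<Sum>x<n. f ((x + c) mod n)) = sum f {..<n}"
proof (rule sum.reindex_bij_betw)
  show "bij_betw (\<lambda>x. (x + c) mod n) {..<n} {..<n}"
    unfolding bij_betw_def
    by (intro conjI inj_on_mod_shift endo_inj_surj) (auto intro: mod_less_divisor)
qed

text \<open>In a moving state \<open>inner a y z q\<close> the outer counters encode the lap values
  \<open>y\<close> and \<open>z\<close>; subtracting \<open>Suc q\<close> modulo \<open>a\<close>
  recovers them. Adding \<open>a\<close> first keeps the subtraction exact.\<close>

lemma mod_shift_cancel: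
  fixes a :: nat
  assumes "q < a"
  shows "y < a \<Longrightarrow> (Suc (y + q) mod a + a - Suc q) mod a = y"
    and "x < a \<Longrightarrow> Suc ((x + a - Suc q) mod a + q) mod a = x"
proof -
  assume y: "y < a"
  have "(Suc (y + q) mod a + a - Suc q) mod a = (Suc (y + q) mod a + (a - Suc q)) mod a"
    using assms by simp
  also have "\<dots> = (Suc (y + q) + (a - Suc q)) mod a" by (rule mod_add_left_eq)
  also have "Suc (y + q) + (a - Suc q) = y + a" using assms by simp
  finally show "(Suc (y + q) mod a + a - Suc q) mod a = y" using y by simp
next
  assume x: "x < a"
  have "Suc ((x + a - Suc q) mod a + q) mod a = ((x + a - Suc q) mod a + Suc q) mod a" by simp
  also have "\<dots> = (x + a - Suc q + Suc q) mod a" by (rule mod_add_left_eq)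
  also have "x + a - Suc q + Suc q = x + a" using assms by simp
  finally show "Suc ((x + a - Suc q) mod a + q) mod a = x" using x by simp
qed

lemma inner_phaseI:
  assumes "y < n" "q \<le> a"
  shows "inner a (i + y) (l + y) q \<in> inner_phase a i l n"
  using assms unfolding inner_phase_def by (intro image_eqI[of _ _ "(y, q)"]) auto

text \<open>Holds on the halves \<open>half_orbit a c\<close>, fails on their mirror images, and thus keeps the two
  halves of \<open>giant_orbit\<close> apart.\<close>

fun upper :: "nat \<Rightarrow> state \<Rightarrow> bool" where
  "upper a (N i j k l) \<longleftrightarrow> k \<noteq> l \<and> (i = j \<or> j = k \<and> (i + a - Suc j) mod a < (l + a - Suc k) mod a)"
| "upper a (LP k l) \<longleftrightarrow> k \<noteq> l"
| "upper a (RP i j) \<longleftrightarrow> False"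
| "upper a PP \<longleftrightarrow> False"
| "upper a (E i l) \<longleftrightarrow> i < l"

lemma not_upper_mirror: "upper a s \<Longrightarrow> \<not> upper a (mirror s)"
  by (cases s) auto

context
  fixes a :: nat
  assumes a2: "2 \<le> a"
begin

lemma inner_neq:
  assumes "y < a - 1" "q < a"
  shows "Suc (y + q) mod a \<noteq> q"
  using add_mod_neq[of "Suc y" a q] assms by (simp add: add.commute)

text \<open>In the semi phase the left pair agrees and the other two counters differ by
  \<open>c\<close>; in the inner phase the recovered lap values are \<open>y\<close> and
  \<open>c + y\<close>, in this order.\<close>

lemma upper_half_orbit:
  assumes "c \<in> {1..<a}" "s \<in> half_orbit a c"
  shows "upper a s" "valid_state a s"
proof -
  have "upper a s \<and> valid_state a s"
    using assms(2) unfolding half_orbit_def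
  proof (elim UnE)
    assume "s \<in> semi_phase a c"
    then obtain p k where "p \<le> a" "k < a" "s = semi a c p k" unfolding semi_phase_def by auto
    moreover have "(k + c) mod a \<noteq> k" using add_mod_neq[of c a k] \<open>k < a\<close> assms(1) by simp
    ultimately show ?thesis by (auto simp: semi_def)
  next
    assume "s \<in> inner_phase a 0 c (a - 1 - c)"
    then obtain y q where yq: "y < a - 1 - c" "q \<le> a" "s = inner a y (c + y) q"
      unfolding inner_phase_def by auto
    show ?thesis
    proof (cases "q = a")
      case True
      then show ?thesis using yq assms(1) by (auto simp: inner_def)
    next
      case False
      then have q: "q < a" using yq by simp
      have "Suc (c + y + q) mod a \<noteq> q" using inner_neq[of "c + y" q] yq q by simp
      moreover have "(Suc (y + q) mod a + a - Suc q) mod a = y"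
        "(Suc (c + y + q) mod a + a - Suc q) mod a = c + y"
        using yq q by (auto intro!: mod_shift_cancel(1))
      ultimately show ?thesis using yq q assms(1) by (simp add: inner_def)
    qed
  qed (use assms(1) in auto)
  then show "upper a s" "valid_state a s" by auto
qed

text \<open>The parameter is the lead of the fourth counter over the third while the left pair
  agrees, and the difference of the lap values while the middle pair agrees.\<close>

lemma half_orbit_cover:
  assumes "upper a s" "valid_state a s"
  obtains c where "c \<in> {1..<a}" "s \<in> half_orbit a c"
proof -
  have semi: "\<exists>c \<in> {1..<a}. semi a c p k \<in> half_orbit a c \<and> (k + c) mod a = l"
    if "p \<le> a" "k < a" "l < a" "k \<noteq> l" for p k l
  proof
    have *: "(k + (l + a - k) mod a) mod a = l"
      using that mod_add_right_eq[of k "l + a - k" a] by simp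
    then have "(l + a - k) mod a \<noteq> 0" using that by (intro notI) simp
    with * show "semi a ((l + a - k) mod a) p k \<in> half_orbit a ((l + a - k) mod a) \<and>
        (k + (l + a - k) mod a) mod a = l"
      using that unfolding half_orbit_def semi_phase_def by auto
    show "(l + a - k) mod a \<in> {1..<a}" using \<open>(l + a - k) mod a \<noteq> 0\<close> a2 by simp
  qed
  have "\<exists>c \<in> {1..<a}. s \<in> half_orbit a c"
  proof (cases s)
    case (N i j k l)
    show ?thesis
    proof (cases "i = j")
      case True
      have "i \<le> a" "k < a" "l < a" "k \<noteq> l" using assms N by auto
      with semi[of i k l] obtain c where "c \<in> {1..<a}" "semi a c i k \<in> half_orbit a c" "(k + c) mod a = l"
        by blast
      moreover have "s = N i i k l" "i \<noteq> a" using True assms N by auto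
      ultimately show ?thesis by (auto simp: semi_def)
    next
      case False
      define y where "y = (i + a - Suc k) mod a"
      define z where "z = (l + a - Suc k) mod a"
      have jk: "j = k" "y < z" using assms N False by (auto simp: y_def z_def)
      have z: "Suc (z + k) mod a = l" and y: "Suc (y + k) mod a = i"
        using assms N by (auto simp: y_def z_def intro!: mod_shift_cancel(2))
      \<comment> \<open>The lap value \<open>a - 1\<close> would put the fourth counter level with
        the third.\<close>
      have "z \<noteq> a - 1"
      proof
        assume "z = a - 1"
        then have "l = k" using z a2 assms N by simp
        then show False using assms N by simp
      qed
      moreover have "z < a" unfolding z_def using a2 by simp
      ultimately have "z < a - 1" by simp
      have "s = inner a y z k" using N y z jk assms by (simp add: inner_def)
      moreover have "k \<le> a" "y < a - 1 - (z - y)" "z - y + y = z"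
        using \<open>z < a - 1\<close> jk assms N by auto
      ultimately have "s \<in> inner_phase a 0 (z - y) (a - 1 - (z - y))"
        using inner_phaseI[of y "a - 1 - (z - y)" k a 0 "z - y"] by simp
      then have "s \<in> half_orbit a (z - y)" unfolding half_orbit_def by blast
      then show ?thesis using jk \<open>z < a\<close> by (intro bexI[of _ "z - y"]) auto
    qed
  next
    case (LP k l)
    then obtain c where "c \<in> {1..<a}" "semi a c a k \<in> half_orbit a c" "(k + c) mod a = l"
      using semi[of a k l] assms by auto
    then show ?thesis using LP by (auto simp: semi_def)
  next
    case (E i l)
    show ?thesis
    proof (cases "l = a - 1")
      \<comment> \<open>With a full fourth arm this is the isolated last state of the half.\<close>
      case True
      then have "s \<in> half_orbit a (l - i)" using E assms by (auto simp: half_orbit_def)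
      then show ?thesis using E assms by (intro bexI[of _ "l - i"]) auto
    next
      case False
      have "s = inner a i l a" using E assms by (simp add: inner_def)
      moreover have "i < a - 1 - (l - i)" "l - i + i = l"
        using False E assms by auto
      ultimately have "s \<in> inner_phase a 0 (l - i) (a - 1 - (l - i))"
        using inner_phaseI[of i "a - 1 - (l - i)" a a 0 "l - i"] by simp
      then have "s \<in> half_orbit a (l - i)" unfolding half_orbit_def by blast
      then show ?thesis using E assms by (intro bexI[of _ "l - i"]) auto
    qed
  qed (use assms in auto)
  with that show ?thesis by blast
qed

lemma free_orbit_mem:
  assumes "i < a" "j < a" "k < a" "l < a" "i \<noteq> j" "j \<noteq> k" "k \<noteq> l"
  obtains \<alpha> \<beta> \<gamma> where "\<alpha> \<in> {1..<a}" "\<beta> \<in> {1..<a}" "\<gamma> \<in> {1..<a}" "N i j k l \<in> free_orbit a \<alpha> \<beta> \<gamma>"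
proof -
  \<comment> \<open>\<open>d x y\<close> is the lead of \<open>y\<close> over \<open>x\<close>; the
    orbit passes the given state at time \<open>k\<close>.\<close>
  define d where "d x y = (y + a - x) mod a" for x y
  have d: "(x + d x y) mod a = y" "d x y \<in> {1..<a}" if "x < a" "y < a" "x \<noteq> y" for x y
  proof -
    show *: "(x + d x y) mod a = y"
      using that mod_add_right_eq[of x "y + a - x" a] by (simp add: d_def)
    then have "d x y \<noteq> 0" using that by (intro notI) simp
    then show "d x y \<in> {1..<a}" using a2 by (simp add: d_def)
  qed
  have "(k + d k j + d j i) mod a = i"
    using d(1)[of k j] d(1)[of j i] assms mod_add_left_eq[of "k + d k j" a "d j i"] by simp
  then have "N i j k l \<in> free_orbit a (d j i) (d k j) (d k l)"
    unfolding free_orbit_def using d(1)[of k j] d(1)[of k l] assms by (intro image_eqI[of _ _ k]) auto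
  with that d(2) assms show ?thesis by metis
qed

lemma paired_orbit_mem:
  assumes "p \<le> a" "q \<le> a" "p \<noteq> q"
  obtains c where "c \<in> {1..a}" "paired a p q \<in> paired_orbit a c"
proof -
  \<comment> \<open>The lead of the left pair; the orbit passes the given state at time
    \<open>q\<close>.\<close>
  define c where "c = (p + Suc a - q) mod Suc a"
  have *: "(q + c) mod Suc a = p"
  proof -
    have "(q + c) mod Suc a = (q + (p + Suc a - q)) mod Suc a" unfolding c_def by (rule mod_add_right_eq)
    also have "q + (p + Suc a - q) = p + Suc a" using assms by simp
    also have "(p + Suc a) mod Suc a = p" unfolding mod_add_self2 using assms by simp
    finally show ?thesis .
  qed
  then have "c \<noteq> 0" using assms by (intro notI) simp
  moreover have "c < Suc a" by (simp add: c_def)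
  moreover have "paired a p q \<in> paired_orbit a c"
    unfolding paired_orbit_def using * assms by (intro image_eqI[of _ _ q]) auto
  ultimately show ?thesis using that[of c] by simp
qed

text \<open>States with \<open>upper\<close>, and their reflections, lie on giant orbits. In a
  remaining state \<open>N i j k l\<close> the outer pairs agree both or not at all. If neither
  agrees, then either the middle pair does and the lap values are equal, or no two neighbours
  agree.\<close>

lemma orbit_cover:
  assumes "valid_state a s"
  shows "(\<exists>\<alpha>\<in>{1..<a}. \<exists>\<beta>\<in>{1..<a}. \<exists>\<gamma>\<in>{1..<a}. s \<in> free_orbit a \<alpha> \<beta> \<gamma>) \<or>
    (\<exists>c\<in>{1..a}. s \<in> paired_orbit a c) \<or> s \<in> long_orbit a \<or> (\<exists>c\<in>{1..<a}. s \<in> giant_orbit a c)"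
    (is "?S \<or> ?M \<or> ?L \<or> ?G")
proof -
  consider "upper a s" | "upper a (mirror s)" | "\<not> upper a s" "\<not> upper a (mirror s)" by blast
  then show ?thesis
  proof cases
    case 1
    with half_orbit_cover assms have ?G unfolding giant_orbit_def by (metis UnI1)
    then show ?thesis by blast
  next
    case 2
    then obtain c where c: "c \<in> {1..<a}" "mirror s \<in> half_orbit a c"
      using half_orbit_cover assms valid_state_mirror by metis
    \<comment> \<open>\<open>c\<close> is rewritten as \<open>a - (a - c)\<close> because the
      reflected half belongs to the orbit with parameter \<open>a - c\<close>.\<close>
    then have "s \<in> mirror ` half_orbit a (a - (a - c))"
      by (intro image_eqI[of _ _ "mirror s"]) (auto simp: mirror_mirror)
    then have "s \<in> giant_orbit a (a - c)" unfolding giant_orbit_def by blast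
    moreover have "a - c \<in> {1..<a}" using c by auto
    ultimately show ?thesis by blast
  next
    case 3
    have diag: "paired a p p \<in> long_orbit a" if "p \<le> a" for p
      using that unfolding long_orbit_def by auto
    have inner: "inner a y y q \<in> long_orbit a" if "y < a - 1" "q \<le> a" for y q
      using that inner_phaseI[of y "a - 1" q a 0 0] unfolding long_orbit_def by simp
    have pair: ?thesis if "s = paired a p q" "p \<le> a" "q \<le> a" for p q
    proof (cases "p = q")
      case True
      then show ?thesis using diag that by simp
    next
      case False
      with that obtain c where "c \<in> {1..a}" "s \<in> paired_orbit a c"
        using paired_orbit_mem by metis
      then show ?thesis by blast
    qed
    show ?thesis
    proof (cases s)
      case (N i j k l)
      show ?thesis
      proof (cases "i = j")
        case True
        have "i \<le> a" "k \<le> a" using assms N by auto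
        moreover have "s = paired a i k" using True 3 N assms by (auto simp: paired_def)
        ultimately show ?thesis using pair by blast
      next
        case False
        then have kl: "k \<noteq> l" using 3 N by auto
        show ?thesis
        proof (cases "j = k")
          case True
          define y where "y = (i + a - Suc k) mod a"
          \<comment> \<open>\<open>upper\<close> fails for the state and for its reflection, so
            neither lap value is the smaller one.\<close>
          have "(i + a - Suc k) mod a = (l + a - Suc k) mod a" using 3 N True False kl by auto
          then have yl: "y = (l + a - Suc k) mod a" by (simp only: y_def)
          have y: "Suc (y + k) mod a = i" unfolding y_def by (rule mod_shift_cancel(2)) (use assms N in auto)
          moreover have "Suc (y + k) mod a = l" unfolding yl by (rule mod_shift_cancel(2)) (use assms N in auto)
          ultimately have il: "i = l" by simp
          have "y \<noteq> a - 1" using y il kl assms N a2 by (intro notI) simp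
          moreover have "y < a" unfolding y_def using a2 by simp
          ultimately have "inner a y y k \<in> long_orbit a" using assms N by (intro inner) auto
          moreover have "s = inner a y y k" using N y il True assms by (simp add: inner_def)
          ultimately show ?thesis by simp
        next
          case nj: False
          obtain \<alpha> \<beta> \<gamma> where "\<alpha> \<in> {1..<a}" "\<beta> \<in> {1..<a}" "\<gamma> \<in> {1..<a}" "s \<in> free_orbit a \<alpha> \<beta> \<gamma>"
            using free_orbit_mem[of i j k l] False nj kl assms unfolding N valid_state.simps by metis
          then show ?thesis by blast
        qed
      qed
    next
      case (LP k l)
      then have "s = paired a a k" "k \<le> a" using 3 assms by (auto simp: paired_def)
      then show ?thesis using pair by blast
    next
      case (RP i j)
      then have "s = paired a i a" "i \<le> a" using 3 assms by (auto simp: paired_def)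
      then show ?thesis using pair by blast
    next
      case PP
      then show ?thesis using diag[of a] by (simp add: paired_def)
    next
      case (E i l)
      then have "s = E i i" "i < a" using 3 assms by auto
      then show ?thesis using inner[of i a] unfolding long_orbit_def by (cases "i = a - 1") (auto simp: inner_def)
    qed
  qed
qed

end

section \<open>Orbit sums\<close>

text \<open>The share of an agreeing pair and its peak in the antichain: two arm elements, then the
  peak alone, then nothing during the pause.\<close>

definition pair_maxima :: "nat \<Rightarrow> nat \<Rightarrow> nat" where
  "pair_maxima a p = (if p = a then 0 else 2 * of_bool (Suc p < a) + of_bool (Suc p = a))"

text \<open>The share of an agreeing pair and its peak in the ideal. The valley belongs to both
  pairs and is counted separately.\<close>

definition pair_size :: "nat \<Rightarrow> nat \<Rightarrow> nat" where
  "pair_size a p = (if p = a then 2 * a - 1 else 2 * p)"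

lemma sum_upto_below: "(\<Sum>x<Suc b. of_bool (x < b)) = b" "(\<Sum>x<Suc b. of_bool (x = b)) = (1::nat)"
proof -
  have "(\<Sum>x<b. of_bool (x < b)) = (\<Sum>x<b. 1 :: nat)" "(\<Sum>x<b. of_bool (x = b)) = (\<Sum>x<b. 0 :: nat)"
    by (rule sum.cong; simp)+
  then show "(\<Sum>x<Suc b. of_bool (x < b)) = b" "(\<Sum>x<Suc b. of_bool (x = b)) = (1::nat)"
    unfolding sum.lessThan_Suc by auto
qed

lemma sum_upto_twice: "2 * (\<Sum>x<n. x) = n * (n - 1 :: nat)"
proof (induction n)
  case (Suc n)
  then show ?case by (cases n) (simp_all add: algebra_simps)
qed simp

section \<open>Sums over each family of states, with \<open>b\<close> for the predecessor of
  \<open>a\<close>\<close>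

context
  fixes a b :: nat
  assumes a: "a = Suc b" and b0: "0 < b"
begin

private lemma a2: "2 \<le> a" using a b0 by simp

lemma sum_below: "(\<Sum>x<a. of_bool (Suc x < a)) = b" "(\<Sum>x<a. of_bool (Suc x = a)) = (1::nat)"
  using sum_upto_below[of b] by (simp_all add: a)

lemma sum_id: "2 * (\<Sum>x<a. x) = a * b"
  using sum_upto_twice[of a] by (simp add: a)

lemma sum_pair_maxima: "sum (pair_maxima a) {..a} = 2 * b + 1"
proof -
  have "sum (pair_maxima a) {..a} = (\<Sum>p<a. 2 * of_bool (Suc p < a) + of_bool (Suc p = a))"
    unfolding lessThan_Suc_atMost[symmetric] sum.lessThan_Suc
    by (simp add: pair_maxima_def)
  then show ?thesis by (simp only: sum.distrib sum_below sum_distrib_left[symmetric])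
qed

lemma sum_pair_size: "sum (pair_size a) {..a} = a * b + 2 * b + 1"
proof -
  have "sum (pair_size a) {..a} = (\<Sum>p<a. 2 * p) + (2 * a - 1)"
    unfolding lessThan_Suc_atMost[symmetric] sum.lessThan_Suc
    by (simp add: pair_size_def)
  also have "\<dots> = a * b + 2 * b + 1"
    unfolding sum_distrib_left[symmetric] sum_id by (simp add: a)
  finally show ?thesis .
qed

lemma card_paired:
  assumes "p \<le> a" "q \<le> a"
  shows "card (antichain_of a (paired a p q)) = pair_maxima a p + pair_maxima a q"
    and "card (ideal_of a (paired a p q)) = pair_size a p + pair_size a q + 1"
    and "valid_state a (paired a p q)"
proof -
  show s: "valid_state a (paired a p q)" using assms by (auto simp: paired_def)
  show "card (antichain_of a (paired a p q)) = pair_maxima a p + pair_maxima a q"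
    using assms a2 unfolding card_antichain_of[OF a2 s]
    by (cases "p = a"; cases "q = a"; cases "Suc p = a"; cases "Suc q = a")
      (simp_all add: paired_def pair_maxima_def)
  show "card (ideal_of a (paired a p q)) = pair_size a p + pair_size a q + 1"
    using assms a2 card_ideal_of[OF a2]
    by (cases "p = a"; cases "q = a") (simp_all add: paired_def pair_size_def)
qed

text \<open>The third and fourth counters never agree, so the right peak stays out of the antichain.
  Both sizes split into a part of \<open>p\<close> and a part of \<open>k\<close>, as is needed for
  summing over the product.\<close>

lemma card_semi:
  assumes "c \<in> {1..<a}" "p \<le> a" "k < a"
  shows "card (antichain_of a (semi a c p k)) =
      pair_maxima a p + (of_bool (Suc k < a) + of_bool (Suc ((k + c) mod a) < a))"
    and "card (ideal_of a (semi a c p k)) = pair_size a p + (k + (k + c) mod a + 1)"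
proof -
  have s: "valid_state a (semi a c p k)" using assms by (auto simp: semi_def)
  have l: "(k + c) mod a < a" "(k + c) mod a \<noteq> k" using assms add_mod_neq[of c a k] by auto
  show "card (antichain_of a (semi a c p k)) =
      pair_maxima a p + (of_bool (Suc k < a) + of_bool (Suc ((k + c) mod a) < a))"
    using assms a2 l unfolding card_antichain_of[OF a2 s]
    by (cases "p = a"; cases "Suc p = a"; cases "Suc k = a")
      (simp_all add: semi_def pair_maxima_def)
  show "card (ideal_of a (semi a c p k)) = pair_size a p + (k + (k + c) mod a + 1)"
    using assms a2 l card_ideal_of[OF a2]
    by (cases "p = a") (simp_all add: semi_def pair_size_def)
qed

text \<open>In the pause the antichain consists of the valley and the next elements of the two outer
  arms. In the moving states the outer counters differ from the middle ones, so no peak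
  enters.\<close>

lemma card_inner:
  assumes "Suc i < a" "Suc l < a"
  shows "card (antichain_of a (inner a i l a)) = 3"
    and "card (ideal_of a (inner a i l a)) = i + l"
    and "q < a \<Longrightarrow> card (antichain_of a (inner a i l q)) =
      of_bool (Suc ((q + Suc i) mod a) < a) + 2 * of_bool (Suc q < a) + of_bool (Suc ((q + Suc l) mod a) < a)"
    and "q < a \<Longrightarrow> card (ideal_of a (inner a i l q)) =
      (q + Suc i) mod a + 2 * q + (q + Suc l) mod a + 1"
proof -
  have "valid_state a (E i l)" using assms by simp
  from card_antichain_of[OF a2 this] show "card (antichain_of a (inner a i l a)) = 3"
    using assms a2 by (simp add: inner_def)
  show "card (ideal_of a (inner a i l a)) = i + l"
    using assms card_ideal_of(5)[OF a2, of i l] by (simp add: inner_def)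
  assume q: "q < a"
  define x y where "x = (q + Suc i) mod a" and "y = (q + Suc l) mod a"
  have xy: "x < a" "y < a" "x \<noteq> q" "y \<noteq> q"
    using add_mod_neq[of "Suc i" a q] add_mod_neq[of "Suc l" a q] assms q by (auto simp: x_def y_def)
  have N: "inner a i l q = N x q q y" using q by (simp add: inner_def x_def y_def add.commute)
  have s: "valid_state a (N x q q y)" using xy q by simp
  show "card (antichain_of a (inner a i l q)) = of_bool (Suc ((q + Suc i) mod a) < a)
      + 2 * of_bool (Suc q < a) + of_bool (Suc ((q + Suc l) mod a) < a)"
    using xy q unfolding x_def[symmetric] y_def[symmetric] N card_antichain_of[OF a2 s]
    by (cases "Suc q = a") simp_all
  show "card (ideal_of a (inner a i l q)) = (q + Suc i) mod a + 2 * q + (q + Suc l) mod a + 1"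
    using xy q card_ideal_of(1)[OF a2, of x q q y] unfolding x_def[symmetric] y_def[symmetric] N by simp
qed

text \<open>No neighbours agree, so each arm contributes on its own, and every counter makes exactly
  one turn.\<close>

lemma sum_free_orbit:
  assumes "\<alpha> \<in> {1..<a}" "\<beta> \<in> {1..<a}" "\<gamma> \<in> {1..<a}"
  shows "card (free_orbit a \<alpha> \<beta> \<gamma>) = a"
    and "(\<Sum>s\<in>free_orbit a \<alpha> \<beta> \<gamma>. card (antichain_of a s)) = 4 * b"
    and "(\<Sum>s\<in>free_orbit a \<alpha> \<beta> \<gamma>. card (ideal_of a s)) = 2 * (a * b) + a"
proof -
  define i j l where "i t = (t + (\<beta> + \<alpha>)) mod a" and "j t = (t + \<beta>) mod a" and "l t = (t + \<gamma>) mod a" for t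
  have F: "free_orbit a \<alpha> \<beta> \<gamma> = (\<lambda>t. N (i t) (j t) t (l t)) ` {..<a}"
    unfolding free_orbit_def i_def j_def l_def by (rule image_cong) (auto simp: add.assoc)
  have inj: "inj_on (\<lambda>t. N (i t) (j t) t (l t)) {..<a}" by (auto intro: inj_onI)
  show "card (free_orbit a \<alpha> \<beta> \<gamma>) = a" unfolding F by (simp add: card_image[OF inj])
  have *: "i t < a" "j t < a" "l t < a" "i t \<noteq> j t" "l t \<noteq> t" "j t \<noteq> t" if "t < a" for t
    using that assms add_mod_neq[of \<alpha> a "t + \<beta>"] add_mod_neq[of \<gamma> a t] add_mod_neq[of \<beta> a t]
    by (auto simp: i_def j_def l_def add.assoc)
  have "card (antichain_of a (N (i t) (j t) t (l t))) =
     of_bool (Suc (i t) < a) + of_bool (Suc (j t) < a) + of_bool (Suc t < a) + of_bool (Suc (l t) < a)"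
    if "t < a" for t
    using *[OF that] that card_antichain_of[OF a2, of "N (i t) (j t) t (l t)"] by auto
  then have "(\<Sum>s\<in>free_orbit a \<alpha> \<beta> \<gamma>. card (antichain_of a s)) = (\<Sum>t<a.
     of_bool (Suc (i t) < a) + of_bool (Suc (j t) < a) + of_bool (Suc t < a) + of_bool (Suc (l t) < a))"
    unfolding F by (simp add: sum.reindex[OF inj])
  also have "\<dots> = 4 * b"
    unfolding sum.distrib i_def j_def l_def sum_mod_shift[where f = "\<lambda>x. of_bool (Suc x < a)"] sum_below by simp
  finally show "(\<Sum>s\<in>free_orbit a \<alpha> \<beta> \<gamma>. card (antichain_of a s)) = 4 * b" .
  have "card (ideal_of a (N (i t) (j t) t (l t))) = i t + j t + t + l t + 1" if "t < a" for t
    using *[OF that] that by (simp add: card_ideal_of(1)[OF a2] del: ideal_of.simps)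
  then have "(\<Sum>s\<in>free_orbit a \<alpha> \<beta> \<gamma>. card (ideal_of a s)) = (\<Sum>t<a. i t + j t + t + l t + 1)"
    unfolding F by (simp add: sum.reindex[OF inj] del: ideal_of.simps)
  also have "\<dots> = 2 * (2 * (\<Sum>x<a. x)) + a"
    unfolding sum.distrib i_def j_def l_def sum_mod_shift[where f = "\<lambda>x. x"] by simp
  finally show "(\<Sum>s\<in>free_orbit a \<alpha> \<beta> \<gamma>. card (ideal_of a s)) = 2 * (a * b) + a"
    unfolding sum_id .
qed

lemma paired_eq_iff:
  "p \<le> a \<Longrightarrow> q \<le> a \<Longrightarrow> p' \<le> a \<Longrightarrow> q' \<le> a \<Longrightarrow> paired a p q = paired a p' q' \<longleftrightarrow> p = p' \<and> q = q'"
  by (auto simp: paired_def split: if_splits)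

lemma sum_paired_orbit:
  shows "card (paired_orbit a c) = Suc a"
    and "(\<Sum>s\<in>paired_orbit a c. card (antichain_of a s)) = 4 * b + 2"
    and "(\<Sum>s\<in>paired_orbit a c. card (ideal_of a s)) = 2 * (a * b + 2 * b + 1) + Suc a"
proof -
  define p where "p t = (t + c) mod Suc a" for t
  have p: "p t \<le> a" for t using mod_less_divisor[of "Suc a" "t + c"] unfolding p_def by linarith
  have F: "paired_orbit a c = (\<lambda>t. paired a (p t) t) ` {..<Suc a}"
    unfolding paired_orbit_def p_def by (rule image_cong) auto
  have inj: "inj_on (\<lambda>t. paired a (p t) t) {..<Suc a}"
    by (rule inj_onI) (auto simp: paired_eq_iff p less_Suc_eq_le)
  show "card (paired_orbit a c) = Suc a" unfolding F by (simp add: card_image[OF inj])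
  have shift: "(\<Sum>t<Suc a. f (p t)) = sum f {..a}" for f :: "nat \<Rightarrow> nat"
    using sum_mod_shift[of f c "Suc a"] unfolding p_def lessThan_Suc_atMost .
  have "(\<Sum>s\<in>paired_orbit a c. card (antichain_of a s)) = (\<Sum>t<Suc a. pair_maxima a (p t) + pair_maxima a t)"
    unfolding F sum.reindex[OF inj] by (rule sum.cong) (auto simp: card_paired p less_Suc_eq_le)
  then show "(\<Sum>s\<in>paired_orbit a c. card (antichain_of a s)) = 4 * b + 2"
    unfolding sum.distrib shift unfolding lessThan_Suc_atMost sum_pair_maxima by simp
  have "(\<Sum>s\<in>paired_orbit a c. card (ideal_of a s)) = (\<Sum>t<Suc a. pair_size a (p t) + pair_size a t + 1)"
    unfolding F sum.reindex[OF inj] by (rule sum.cong) (auto simp: card_paired p less_Suc_eq_le)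
  also have "\<dots> = (\<Sum>t<Suc a. pair_size a (p t)) + (\<Sum>t<Suc a. pair_size a t) + Suc a"
    unfolding sum.distrib by simp
  also have "\<dots> = 2 * (a * b + 2 * b + 1) + Suc a"
    unfolding shift unfolding lessThan_Suc_atMost sum_pair_size by simp
  finally show "(\<Sum>s\<in>paired_orbit a c. card (ideal_of a s)) = 2 * (a * b + 2 * b + 1) + Suc a" .
qed

lemma sum_semi_phase:
  assumes "c \<in> {1..<a}"
  shows "card (semi_phase a c) = a * Suc a"
    and "(\<Sum>s\<in>semi_phase a c. card (antichain_of a s)) = a * (2 * b + 1) + Suc a * (2 * b)"
    and "(\<Sum>s\<in>semi_phase a c. card (ideal_of a s)) = a * (a * b + 2 * b + 1) + Suc a * (a * b + a)"
proof -
  have inj: "inj_on (\<lambda>(p, k). semi a c p k) ({..a} \<times> {..<a})"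
    by (rule inj_onI) (auto simp: semi_def split: if_splits)
  show "card (semi_phase a c) = a * Suc a"
    unfolding semi_phase_def card_image[OF inj] by (simp add: card_cartesian_product)
  have S: "sum g (semi_phase a c) = (\<Sum>p\<le>a. \<Sum>k<a. g (semi a c p k))" for g :: "state \<Rightarrow> nat"
    unfolding semi_phase_def sum.reindex[OF inj] sum.cartesian_product by (rule sum.cong) auto
  \<comment> \<open>A summand that splits in this way needs only the two separate sums over full
    turns.\<close>
  have sep: "(\<Sum>p\<le>a. \<Sum>k<a. f p + h k) = a * sum f {..a} + Suc a * sum h {..<a}" for f h :: "nat \<Rightarrow> nat"
    by (simp add: sum.distrib sum_distrib_left)
  have "(\<Sum>s\<in>semi_phase a c. card (antichain_of a s)) =
     (\<Sum>p\<le>a. \<Sum>k<a. pair_maxima a p + (of_bool (Suc k < a) + of_bool (Suc ((k + c) mod a) < a)))"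
    unfolding S using card_semi(1)[OF assms] by (intro sum.cong) auto
  also have "\<dots> = a * (2 * b + 1) + Suc a * (2 * b)"
    unfolding sep unfolding sum_pair_maxima sum.distrib sum_mod_shift[where f = "\<lambda>x. of_bool (Suc x < a)"] sum_below by simp
  finally show "(\<Sum>s\<in>semi_phase a c. card (antichain_of a s)) = a * (2 * b + 1) + Suc a * (2 * b)" .
  have "(\<Sum>s\<in>semi_phase a c. card (ideal_of a s)) =
     (\<Sum>p\<le>a. \<Sum>k<a. pair_size a p + (k + (k + c) mod a + 1))"
    unfolding S using card_semi(2)[OF assms] by (intro sum.cong) auto
  also have "\<dots> = a * (a * b + 2 * b + 1) + Suc a * (2 * (\<Sum>x<a. x) + a)"
    unfolding sep unfolding sum_pair_size sum.distrib sum_mod_shift[where f = "\<lambda>x. x"] by simp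
  finally show "(\<Sum>s\<in>semi_phase a c. card (ideal_of a s)) = a * (a * b + 2 * b + 1) + Suc a * (a * b + a)"
    unfolding sum_id .
qed

lemma sum_inner_phase:
  assumes "i + n < a" "l + n < a"
  shows "card (inner_phase a i l n) = n * Suc a"
    and "(\<Sum>s\<in>inner_phase a i l n. card (antichain_of a s)) = n * (4 * b + 3)"
    and "(\<Sum>s\<in>inner_phase a i l n. card (ideal_of a s)) = n * (i + l) + n * (n - 1) + n * (2 * (a * b) + a)"
proof -
  \<comment> \<open>The middle counter, or the missing valley, gives \<open>q\<close>; the first
    counter then gives the lap.\<close>
  have inj: "inj_on (\<lambda>(y, q). inner a (i + y) (l + y) q) ({..<n} \<times> {..a})"
  proof (rule inj_onI, clarify)
    fix y q y' q' assume yq: "y < n" "q \<le> a" "y' < n" "q' \<le> a"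
      and eq: "inner a (i + y) (l + y) q = inner a (i + y') (l + y') q'"
    then have q: "q = q'" by (auto simp: inner_def split: if_splits)
    show "y = y' \<and> q = q'"
    proof (cases "q = a")
      case True
      then show ?thesis using eq q by (simp add: inner_def)
    next
      case False
      then have "(i + y + Suc q) mod a = (i + y' + Suc q) mod a" using eq q by (simp add: inner_def)
      moreover have "i + y \<in> {..<a}" "i + y' \<in> {..<a}" using yq assms by auto
      ultimately have "i + y = i + y'" using inj_onD[OF inj_on_mod_shift[of "Suc q" a]] by blast
      then show ?thesis using q by simp
    qed
  qed
  show "card (inner_phase a i l n) = n * Suc a"
    unfolding inner_phase_def card_image[OF inj] by (simp add: card_cartesian_product)
  \<comment> \<open>Each lap is split into its \<open>a\<close> moving states and the pause.\<close>
  have S: "sum g (inner_phase a i l n) =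
     (\<Sum>y<n. (\<Sum>q<a. g (inner a (i + y) (l + y) q)) + g (inner a (i + y) (l + y) a))" for g :: "state \<Rightarrow> nat"
  proof -
    have "sum g (inner_phase a i l n) = (\<Sum>(y, q)\<in>{..<n} \<times> {..a}. g (inner a (i + y) (l + y) q))"
      unfolding inner_phase_def sum.reindex[OF inj] by (rule sum.cong) auto
    then show ?thesis
      by (simp only: sum.cartesian_product[symmetric] lessThan_Suc_atMost[symmetric] sum.lessThan_Suc)
  qed
  have bound: "Suc (i + y) < a" "Suc (l + y) < a" if "y < n" for y using assms that by auto
  have "(\<Sum>q<a. card (antichain_of a (inner a (i + y) (l + y) q))) = 4 * b" if "y < n" for y
  proof -
    have "(\<Sum>q<a. card (antichain_of a (inner a (i + y) (l + y) q))) =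
       (\<Sum>q<a. of_bool (Suc ((q + Suc (i + y)) mod a) < a) + 2 * of_bool (Suc q < a)
          + of_bool (Suc ((q + Suc (l + y)) mod a) < a))"
      using card_inner(3)[OF bound[OF that]] by (intro sum.cong) auto
    also have "\<dots> = 4 * b"
      unfolding sum.distrib sum_mod_shift[where f = "\<lambda>x. of_bool (Suc x < a)"]
        sum_distrib_left[symmetric] sum_below by simp
    finally show ?thesis .
  qed
  then show "(\<Sum>s\<in>inner_phase a i l n. card (antichain_of a s)) = n * (4 * b + 3)"
    unfolding S using card_inner(1)[OF bound] by simp
  have "(\<Sum>q<a. card (ideal_of a (inner a (i + y) (l + y) q))) = 2 * (a * b) + a" if "y < n" for y
  proof -
    have "(\<Sum>q<a. card (ideal_of a (inner a (i + y) (l + y) q))) =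
       (\<Sum>q<a. (q + Suc (i + y)) mod a + 2 * q + (q + Suc (l + y)) mod a + 1)"
      using card_inner(4)[OF bound[OF that]] by (intro sum.cong) auto
    also have "\<dots> = 2 * (2 * (\<Sum>x<a. x)) + a"
      unfolding sum.distrib sum_mod_shift[where f = "\<lambda>x. x"]
        sum_distrib_left[symmetric] by simp
    finally show ?thesis unfolding sum_id .
  qed
  then have "(\<Sum>s\<in>inner_phase a i l n. card (ideal_of a s)) =
      (\<Sum>y<n. (2 * (a * b) + a) + (i + l) + 2 * y)"
    unfolding S using card_inner(2)[OF bound] by (intro sum.cong) auto
  also have "\<dots> = n * (2 * (a * b) + a) + n * (i + l) + 2 * (\<Sum>y<n. y)"
    unfolding sum.distrib sum_distrib_left[symmetric] by (simp add: add_mult_distrib2)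
  also have "\<dots> = n * (i + l) + n * (n - 1) + n * (2 * (a * b) + a)"
    unfolding sum_upto_twice by simp
  finally show "(\<Sum>s\<in>inner_phase a i l n. card (ideal_of a s)) =
    n * (i + l) + n * (n - 1) + n * (2 * (a * b) + a)" .
qed

lemma card_mirror:
  assumes "valid_state a s"
  shows "card (antichain_of a (mirror s)) = card (antichain_of a s)"
    and "card (ideal_of a (mirror s)) = card (ideal_of a s)"
proof -
  have m: "valid_state a (mirror s)" using assms by (simp add: valid_state_mirror)
  have "h1 a (mirror s) = h4 a s" "h2 a (mirror s) = h3 a s" "h3 a (mirror s) = h2 a s" "h4 a (mirror s) = h1 a s"
    "valley (mirror s) = valley s" "peak1 (mirror s) = peak2 s" "peak2 (mirror s) = peak1 s"
    by (cases s; simp)+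
  then show "card (antichain_of a (mirror s)) = card (antichain_of a s)"
    unfolding card_antichain_of[OF a2 assms] card_antichain_of[OF a2 m]
    by (simp only: conj_ac add_ac)
  show "card (ideal_of a (mirror s)) = card (ideal_of a s)"
    using assms card_ideal_of[OF a2] by (cases s) (simp_all del: ideal_of.simps)
qed

lemma sum_half_orbit:
  assumes "c \<in> {1..<a}"
  shows "card (half_orbit a c) = a * Suc a + (b - c) * Suc a + 1"
    and "(\<Sum>s\<in>half_orbit a c. card (antichain_of a s)) =
      a * (2 * b + 1) + Suc a * (2 * b) + (b - c) * (4 * b + 3) + 2"
    and "(\<Sum>s\<in>half_orbit a c. card (ideal_of a s)) =
      a * (a * b + 2 * b + 1) + Suc a * (a * b + a) + (b - c) * (b - 1 + 2 * (a * b) + a) + b + (b - c)"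
proof -
  define n where "n = b - c"
  have n: "a - 1 - c = n" "n + c = b" "0 < c" using assms by (auto simp: n_def a)
  \<comment> \<open>In the semi phase the valley is present and the first two counters agree; in the
    inner phase one of the two fails. The isolated state would be the pause of lap \<open>n\<close>,
    while the laps stop before \<open>n\<close>.\<close>
  have disj: "semi_phase a c \<inter> (inner_phase a 0 c n \<union> {E n b}) = {}" "E n b \<notin> inner_phase a 0 c n"
  proof -
    have "s \<notin> semi_phase a c" if "s \<in> inner_phase a 0 c n" for s
    proof
      assume "s \<in> semi_phase a c"
      then obtain p k where pk: "s = semi a c p k" "p \<le> a" "k < a" by (auto simp: semi_phase_def)
      from that obtain y q where yq: "s = inner a y (c + y) q" "y < n" "q \<le> a" by (auto simp: inner_phase_def)
      then show False using pk inner_neq[OF a2, of y q] n a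
        by (auto simp: semi_def inner_def split: if_splits)
    qed
    moreover have "E n b \<notin> semi_phase a c" by (auto simp: semi_phase_def semi_def split: if_splits)
    ultimately show "semi_phase a c \<inter> (inner_phase a 0 c n \<union> {E n b}) = {}" by blast
    show "E n b \<notin> inner_phase a 0 c n" by (auto simp: inner_phase_def inner_def split: if_splits)
  qed
  have fin: "finite (semi_phase a c)" "finite (inner_phase a 0 c n)"
    by (simp_all add: semi_phase_def inner_phase_def)
  have H: "half_orbit a c = semi_phase a c \<union> (inner_phase a 0 c n \<union> {E n b})"
    unfolding half_orbit_def n(1) by (simp add: a)
  have S: "sum g (half_orbit a c) = sum g (semi_phase a c) + (sum g (inner_phase a 0 c n) + g (E n b))"
    for g :: "state \<Rightarrow> nat"
    unfolding H using disj fin by (simp add: sum.union_disjoint)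
  have inn: "0 + n < a" "c + n < a" using n a by auto
  note semi = sum_semi_phase[OF assms] and inner = sum_inner_phase[OF inn]
  show "card (half_orbit a c) = a * Suc a + (b - c) * Suc a + 1"
    unfolding H n_def[symmetric] using disj fin semi(1) inner(1) by (simp add: card_Un_disjoint)
  have "valid_state a (E n b)" using n a by simp
  from card_antichain_of[OF a2 this] have "card (antichain_of a (E n b)) = 2"
    using n a by simp
  then show "(\<Sum>s\<in>half_orbit a c. card (antichain_of a s)) =
      a * (2 * b + 1) + Suc a * (2 * b) + (b - c) * (4 * b + 3) + 2"
    unfolding S semi inner n_def[symmetric] by simp
  have "card (ideal_of a (E n b)) = n + b"
    using n a by (intro card_ideal_of(5)[OF a2]) auto
  \<comment> \<open>Since \<open>n + c = b\<close>, the quadratic total of the pause sizes becomes a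
    multiple of \<open>n\<close> with a factor free of \<open>c\<close>, so the two halves of a
    giant orbit can be added up.\<close>
  moreover have "n * (0 + c) + n * (n - 1) = n * (b - 1)"
    using n(2,3) by (cases n) (simp_all add: algebra_simps flip: n(2))
  ultimately show "(\<Sum>s\<in>half_orbit a c. card (ideal_of a s)) =
      a * (a * b + 2 * b + 1) + Suc a * (a * b + a) + (b - c) * (b - 1 + 2 * (a * b) + a) + b + (b - c)"
    unfolding S semi inner n_def[symmetric] by (simp only: add_mult_distrib2)
qed

lemma sum_giant_orbit:
  assumes c: "c \<in> {1..<a}"
  shows "card (giant_orbit a c) = 2 * (a * Suc a) + (b - 1) * Suc a + 2"
    and "(\<Sum>s\<in>giant_orbit a c. card (antichain_of a s)) =
      2 * (a * (2 * b + 1) + Suc a * (2 * b)) + (b - 1) * (4 * b + 3) + 4"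
    and "(\<Sum>s\<in>giant_orbit a c. card (ideal_of a s)) =
      2 * (a * (a * b + 2 * b + 1) + Suc a * (a * b + a)) + (b - 1) * (b - 1 + 2 * (a * b) + a) + 2 * b + (b - 1)"
proof -
  have c': "a - c \<in> {1..<a}" using c by auto
  have disj: "half_orbit a c \<inter> mirror ` half_orbit a (a - c) = {}"
  proof -
    have "s \<notin> mirror ` half_orbit a (a - c)" if s: "s \<in> half_orbit a c" for s
    proof
      assume "s \<in> mirror ` half_orbit a (a - c)"
      then obtain t where "t \<in> half_orbit a (a - c)" "s = mirror t" by blast
      then show False
        using upper_half_orbit(1)[OF a2 c s] upper_half_orbit(1)[OF a2 c'] not_upper_mirror by blast
    qed
    then show ?thesis by blast
  qed
  have fin: "finite (half_orbit a d)" for d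
    by (simp add: half_orbit_def semi_phase_def inner_phase_def)
  have inj: "inj_on mirror A" for A using inj_mirror by (rule inj_on_subset) simp
  have S: "sum g (giant_orbit a c) = sum g (half_orbit a c) + sum g (half_orbit a (a - c))"
    if "\<And>s. valid_state a s \<Longrightarrow> g (mirror s) = g s" for g :: "state \<Rightarrow> nat"
    unfolding giant_orbit_def using disj fin that upper_half_orbit(2)[OF a2 c']
    by (simp add: sum.union_disjoint sum.reindex[OF inj])
  \<comment> \<open>The numbers of laps in the two halves add up to \<open>b - 1\<close>, so the
    parameter cancels from all three values.\<close>
  have bc: "b - 1 = (b - c) + (b - (a - c))" using c a by auto
  note half = sum_half_orbit[OF c] sum_half_orbit[OF c']
  have "card (giant_orbit a c) = card (half_orbit a c) + card (half_orbit a (a - c))"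
    unfolding giant_orbit_def using disj fin by (simp add: card_Un_disjoint card_image[OF inj])
  then show "card (giant_orbit a c) = 2 * (a * Suc a) + (b - 1) * Suc a + 2"
    unfolding half bc add_mult_distrib by presburger
  have "(\<Sum>s\<in>giant_orbit a c. card (antichain_of a s)) =
      (\<Sum>s\<in>half_orbit a c. card (antichain_of a s)) + (\<Sum>s\<in>half_orbit a (a - c). card (antichain_of a s))"
    by (rule S) (rule card_mirror(1))
  then show "(\<Sum>s\<in>giant_orbit a c. card (antichain_of a s)) =
      2 * (a * (2 * b + 1) + Suc a * (2 * b)) + (b - 1) * (4 * b + 3) + 4"
    unfolding half bc add_mult_distrib[of "b - c"] by presburger
  define w where "w = b - 1 + 2 * (a * b) + a"
  have "(\<Sum>s\<in>giant_orbit a c. card (ideal_of a s)) =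
      (\<Sum>s\<in>half_orbit a c. card (ideal_of a s)) + (\<Sum>s\<in>half_orbit a (a - c). card (ideal_of a s))"
    by (rule S) (rule card_mirror(2))
  then show "(\<Sum>s\<in>giant_orbit a c. card (ideal_of a s)) =
      2 * (a * (a * b + 2 * b + 1) + Suc a * (a * b + a)) + (b - 1) * (b - 1 + 2 * (a * b) + a) + 2 * b + (b - 1)"
    unfolding half w_def[symmetric] unfolding bc add_mult_distrib[of "b - c"] by presburger
qed

lemma sum_long_orbit:
  shows "card (long_orbit a) = b * Suc a + 1 + Suc a"
    and "(\<Sum>s\<in>long_orbit a. card (antichain_of a s)) = b * (4 * b + 3) + 1 + 2 * (2 * b + 1)"
    and "(\<Sum>s\<in>long_orbit a. card (ideal_of a s)) =
      b * (b - 1) + b * (2 * (a * b) + a) + 2 * b + (2 * (a * b + 2 * b + 1) + Suc a)"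
proof -
  define D where "D = (\<lambda>p. paired a p p) ` {..a}"
  have inj: "inj_on (\<lambda>p. paired a p p) {..a}"
    by (rule inj_onI) (simp add: paired_eq_iff)
  have disj: "inner_phase a 0 0 b \<inter> ({E b b} \<union> D) = {}" "E b b \<notin> D"
  proof -
    have "s \<notin> D" if "s \<in> inner_phase a 0 0 b" for s
    proof
      assume "s \<in> D"
      then obtain p where p: "s = paired a p p" "p \<le> a" by (auto simp: D_def)
      from that obtain y q where yq: "s = inner a y y q" "y < b" "q \<le> a" by (auto simp: inner_phase_def)
      then show False using p inner_neq[OF a2, of y q] a
        by (auto simp: paired_def inner_def split: if_splits)
    qed
    moreover have "E b b \<notin> inner_phase a 0 0 b" by (auto simp: inner_phase_def inner_def split: if_splits)
    ultimately show "inner_phase a 0 0 b \<inter> ({E b b} \<union> D) = {}" by blast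
    show "E b b \<notin> D" by (auto simp: D_def paired_def split: if_splits)
  qed
  have fin: "finite D" "finite (inner_phase a 0 0 b)"
    by (simp_all add: D_def inner_phase_def)
  have L: "long_orbit a = inner_phase a 0 0 b \<union> ({E b b} \<union> D)"
    unfolding long_orbit_def D_def by (simp add: a)
  have S: "sum g (long_orbit a) = sum g (inner_phase a 0 0 b) + (g (E b b) + sum g D)" for g :: "state \<Rightarrow> nat"
    unfolding L using disj fin by (simp add: sum.union_disjoint)
  have inn: "0 + b < a" using a by simp
  note inner = sum_inner_phase[OF inn inn]
  have "card D = Suc a" unfolding D_def card_image[OF inj] by simp
  then show "card (long_orbit a) = b * Suc a + 1 + Suc a"
    unfolding L using disj fin inner(1) by (simp add: card_Un_disjoint)
  have "(\<Sum>s\<in>D. card (antichain_of a s)) = 2 * (2 * b + 1)"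
    unfolding D_def sum.reindex[OF inj] sum_pair_maxima[symmetric] sum_distrib_left
    by (rule sum.cong) (auto simp: card_paired)
  \<comment> \<open>With both outer arms full, the missing valley is the only minimal element
    left.\<close>
  moreover have "valid_state a (E b b)" using a by simp
  from card_antichain_of[OF a2 this] have "card (antichain_of a (E b b)) = 1"
    using a b0 by simp
  ultimately show "(\<Sum>s\<in>long_orbit a. card (antichain_of a s)) = b * (4 * b + 3) + 1 + 2 * (2 * b + 1)"
    unfolding S inner by presburger
  have "(\<Sum>s\<in>D. card (ideal_of a s)) = (\<Sum>p\<le>a. 2 * pair_size a p + 1)"
    unfolding D_def sum.reindex[OF inj] by (rule sum.cong) (auto simp: card_paired)
  also have "\<dots> = 2 * (a * b + 2 * b + 1) + Suc a"
    unfolding sum.distrib sum_distrib_left[symmetric] sum_pair_size by simp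
  finally have "(\<Sum>s\<in>D. card (ideal_of a s)) = 2 * (a * b + 2 * b + 1) + Suc a" .
  moreover have "card (ideal_of a (E b b)) = 2 * b"
    using card_ideal_of(5)[OF a2, of b b] a by simp
  ultimately show "(\<Sum>s\<in>long_orbit a. card (ideal_of a s)) =
      b * (b - 1) + b * (2 * (a * b) + a) + 2 * b + (2 * (a * b + 2 * b + 1) + Suc a)"
    unfolding S inner by simp
qed

end

section \<open>Orbits of antichains\<close>

context
  fixes a :: nat
  assumes a2: "2 \<le> a"
begin

lemma free_orbit_states: "free_orbit a \<alpha> \<beta> \<gamma> \<subseteq> {s. valid_state a s}"
  using a2 by (auto simp: free_orbit_def)

lemma paired_states: "p \<le> a \<Longrightarrow> q \<le> a \<Longrightarrow> valid_state a (paired a p q)"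
  by (auto simp: paired_def)

lemma paired_orbit_states: "paired_orbit a c \<subseteq> {s. valid_state a s}"
proof -
  have "x mod Suc a \<le> a" for x using mod_less_divisor[of "Suc a" x] by linarith
  then show ?thesis using paired_states by (auto simp: paired_orbit_def)
qed

lemma giant_orbit_states: "c \<in> {1..<a} \<Longrightarrow> giant_orbit a c \<subseteq> {s. valid_state a s}"
  using upper_half_orbit(2)[OF a2, of c] upper_half_orbit(2)[OF a2, of "a - c"]
  by (auto simp: giant_orbit_def valid_state_mirror)

lemma long_orbit_states: "long_orbit a \<subseteq> {s. valid_state a s}"
  using a2 paired_states by (auto simp: long_orbit_def inner_phase_def inner_def)

text \<open>\<open>antichain_of\<close> is injective and carries \<open>step\<close> to rowmotion,
  so a cycle of states becomes an orbit of the same size.\<close>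

lemma antichain_orbit:
  assumes cyc: "cyclic_on (step a) Q" and Q: "Q \<subseteq> {s. valid_state a s}"
  shows "A \<in> antichain_of a ` Q \<Longrightarrow>
      orbit (rowmotion (fence_carrier a) (fence_order a)) A = antichain_of a ` Q"
    and "antichain_of a ` Q \<in> antichain_orbits (fence_carrier a) (fence_order a)"
    and "card (antichain_of a ` Q) = card Q"
    and "chi (antichain_of a ` Q) = (\<Sum>s\<in>Q. card (antichain_of a s))"
    and "chi_hat (fence_carrier a) (fence_order a) (antichain_of a ` Q) = (\<Sum>s\<in>Q. card (ideal_of a s))"
proof -
  have inj: "inj_on (antichain_of a) Q" "inj_on (step a) Q" "inj_on (ideal_of a) Q"
    using inj_on_antichain_of[OF a2] inj_on_step[OF a2] inj_on_ideal_of[OF a2] Q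
    by (blast intro: inj_on_subset)+
  have "cyclic_on (rowmotion (fence_carrier a) (fence_order a)) (antichain_of a ` Q)"
    using cyc by (rule cyclic_on_image) (use rowmotion_antichain_of[OF a2] Q in auto)
  then show orb: "orbit (rowmotion (fence_carrier a) (fence_order a)) A = antichain_of a ` Q"
    if "A \<in> antichain_of a ` Q" for A using that by (rule orbit_cyclic_eq3)
  have ne: "Q \<noteq> {}" using cyc by (simp add: cyclic_on_alldef)
  then obtain s where s: "s \<in> Q" by blast
  then have "antichain_of a s \<in> antichains (fence_carrier a) (fence_order a)"
    using Q unfolding antichain_of_image[OF a2, symmetric] by blast
  with s orb show "antichain_of a ` Q \<in> antichain_orbits (fence_carrier a) (fence_order a)"
    unfolding antichain_orbits_def by (metis imageI)
  show "card (antichain_of a ` Q) = card Q" using inj(1) by (rule card_image)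
  show "chi (antichain_of a ` Q) = (\<Sum>s\<in>Q. card (antichain_of a s))"
    unfolding chi_def sum.reindex[OF inj(1)] by simp
  \<comment> \<open>The generated ideals belong to the successor states. As \<open>step\<close>
    permutes the cycle, this shift does not change the sum over ideals.\<close>
  have "step a ` Q = Q"
    using finite_cyclic_on[OF cyc] cyclic_on_inI[OF cyc] inj(2) by (intro endo_inj_surj) auto
  moreover have "ideal_orbit (fence_carrier a) (fence_order a) (antichain_of a ` Q) = ideal_of a ` step a ` Q"
    unfolding ideal_orbit_def image_image
    by (rule image_cong) (use Q generated_ideal_antichain_of[OF a2] in auto)
  ultimately show "chi_hat (fence_carrier a) (fence_order a) (antichain_of a ` Q) = (\<Sum>s\<in>Q. card (ideal_of a s))"
    unfolding chi_hat_def by (simp add: sum.reindex[OF inj(3)])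
qed

section \<open>The number of orbits in each family\<close>

lemma card_orbit_family:
  assumes "\<And>x. x \<in> X \<Longrightarrow> F x \<subseteq> {s. valid_state a s}" "inj_on F X"
  shows "card ((\<lambda>x. antichain_of a ` F x) ` X) = card X"
proof (rule card_image, rule inj_onI)
  fix x y assume "x \<in> X" "y \<in> X" "antichain_of a ` F x = antichain_of a ` F y"
  then have "F x = F y"
    using inj_on_image_eq_iff[OF inj_on_antichain_of[OF a2], of "F x" "F y"] assms(1) by simp
  with assms(2) show "x = y" using \<open>x \<in> X\<close> \<open>y \<in> X\<close> by (rule inj_onD)
qed

lemma inj_free_orbit:
  "inj_on (\<lambda>(\<alpha>, \<beta>, \<gamma>). free_orbit a \<alpha> \<beta> \<gamma>) ({1..<a} \<times> {1..<a} \<times> {1..<a})"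
proof (rule inj_onI, simp only: split_paired_all mem_Sigma_iff prod.case prod.inject, elim conjE)
  fix \<alpha> \<beta> \<gamma> \<alpha>' \<beta>' \<gamma>'
  assume b: "\<alpha> \<in> {1..<a}" "\<beta> \<in> {1..<a}" "\<gamma> \<in> {1..<a}" "\<alpha>' \<in> {1..<a}" "\<beta>' \<in> {1..<a}" "\<gamma>' \<in> {1..<a}"
    and eq: "free_orbit a \<alpha> \<beta> \<gamma> = free_orbit a \<alpha>' \<beta>' \<gamma>'"
  \<comment> \<open>The third counter is 0 only at time 0, so this state reveals all
    offsets.\<close>
  have "N ((\<beta> + \<alpha>) mod a) \<beta> 0 \<gamma> \<in> free_orbit a \<alpha> \<beta> \<gamma>"
    unfolding free_orbit_def using b by (intro image_eqI[of _ _ 0]) auto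
  then have "N ((\<beta> + \<alpha>) mod a) \<beta> 0 \<gamma> \<in> free_orbit a \<alpha>' \<beta>' \<gamma>'" using eq by simp
  then have "(\<beta> + \<alpha>) mod a = (\<beta>' + \<alpha>') mod a" "\<beta> = \<beta>'" "\<gamma> = \<gamma>'"
    unfolding free_orbit_def using b by auto
  moreover from this have "(\<alpha> + \<beta>) mod a = (\<alpha>' + \<beta>) mod a" by (simp add: add.commute)
  then have "\<alpha> = \<alpha>'" by (rule inj_onD[OF inj_on_mod_shift]) (use b in auto)
  ultimately show "\<alpha> = \<alpha>' \<and> \<beta> = \<beta>' \<and> \<gamma> = \<gamma>'" by simp
qed

lemma inj_paired_orbit: "inj_on (paired_orbit a) {1..a}"
proof (rule inj_onI)
  fix c d assume b: "c \<in> {1..a}" "d \<in> {1..a}" and eq: "paired_orbit a c = paired_orbit a d"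
  \<comment> \<open>The right pair is at 0 only at time 0, and there the left pair shows the
    parameter.\<close>
  have "paired a c 0 \<in> paired_orbit a c"
    unfolding paired_orbit_def using b by (intro image_eqI[of _ _ 0]) auto
  then have "paired a c 0 \<in> paired_orbit a d" using eq by simp
  then obtain t where t: "t < Suc a" "paired a c 0 = paired a ((t + d) mod Suc a) t"
    unfolding paired_orbit_def by auto
  moreover have "(t + d) mod Suc a \<le> a" using mod_less_divisor[of "Suc a" "t + d"] by linarith
  moreover obtain b where "a = Suc b" "0 < b" using a2 by (cases a) auto
  ultimately have "c = (t + d) mod Suc a" "0 = t" using paired_eq_iff[of a b c 0 "(t + d) mod Suc a" t] b by auto
  then show "c = d" using b by simp
qed

lemma inj_giant_orbit: "inj_on (giant_orbit a) {1..<a}"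
proof (rule inj_onI)
  fix c d assume b: "c \<in> {1..<a}" "d \<in> {1..<a}" and eq: "giant_orbit a c = giant_orbit a d"
  \<comment> \<open>This is the first state of the inner phase. For \<open>c = a - 1\<close> there
    are no laps, and it is the isolated last state instead.\<close>
  have "E 0 c \<in> half_orbit a c"
  proof (cases "c = a - 1")
    case False
    then have "0 < a - 1 - c" using b by auto
    then show ?thesis using inner_phaseI[of 0 "a - 1 - c" a a 0 c]
      by (simp add: half_orbit_def inner_def)
  qed (auto simp: half_orbit_def)
  then have "E 0 c \<in> giant_orbit a d" using eq by (auto simp: giant_orbit_def)
  moreover have "E 0 c \<notin> mirror ` half_orbit a (a - d)"
  proof
    assume "E 0 c \<in> mirror ` half_orbit a (a - d)"
    then obtain t where "t \<in> half_orbit a (a - d)" "E 0 c = mirror t" by blast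
    then have "\<not> upper a (E 0 c)" using not_upper_mirror upper_half_orbit(1)[OF a2, of "a - d" t] b by force
    then show False using b by simp
  qed
  ultimately have "E 0 c \<in> half_orbit a d" by (simp add: giant_orbit_def)
  then show "c = d"
    using b by (auto simp: half_orbit_def semi_phase_def semi_def inner_phase_def inner_def split: if_splits)
qed

end

theorem theorem4p5:
  fixes a :: nat
  assumes "a \<ge> 2"
  shows "\<exists>S M L G :: nat set set set.
      S \<union> M \<union> L \<union> G = antichain_orbits (fence_carrier a) (fence_order a) \<and>
      S \<inter> M = {} \<and> S \<inter> L = {} \<and> S \<inter> G = {} \<and> M \<inter> L = {} \<and> M \<inter> G = {} \<and> L \<inter> G = {} \<and>
      card S = (a - 1) ^ 3 \<and> card M = a \<and> card L = 1 \<and> card G = a - 1 \<and>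
      (\<forall>Orb\<in>S. card Orb = a) \<and>
      (\<forall>Orb\<in>M. card Orb = a + 1) \<and>
      (\<forall>Orb\<in>L. card Orb = a ^ 2 + a + 1) \<and>
      (\<forall>Orb\<in>G. card Orb = 3 * a ^ 2 + a) \<and>
      homometric (antichain_orbits (fence_carrier a) (fence_order a)) card \<and>
      homometric (ideal_orbits (fence_carrier a) (fence_order a)) card \<and>
      (\<forall>Orb\<in>S. int (chi Orb) = 4 * int a - 4) \<and>
      (\<forall>Orb\<in>M. int (chi Orb) = 4 * int a - 2) \<and>
      (\<forall>Orb\<in>L. int (chi Orb) = 4 * int a ^ 2 - int a) \<and>
      (\<forall>Orb\<in>G. int (chi Orb) = 12 * int a ^ 2 - 11 * int a + 2) \<and>
      (\<forall>Orb\<in>S. int (chi_hat (fence_carrier a) (fence_order a) Orb) = 2 * int a ^ 2 - int a) \<and>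
      (\<forall>Orb\<in>M. int (chi_hat (fence_carrier a) (fence_order a) Orb) = 2 * int a ^ 2 + 3 * int a - 1) \<and>
      (\<forall>Orb\<in>L. int (chi_hat (fence_carrier a) (fence_order a) Orb) = 2 * int a ^ 3 + 3 * int a - 1) \<and>
      (\<forall>Orb\<in>G. int (chi_hat (fence_carrier a) (fence_order a) Orb) = 6 * int a ^ 3 - int a)"
proof -
  obtain b where a: "a = Suc b" and b0: "0 < b" using assms by (cases a) auto
  define F where "F = {1..<a} \<times> {1..<a} \<times> {1..<a}"
  define Q where "Q = (\<lambda>(\<alpha>, \<beta>, \<gamma>). free_orbit a \<alpha> \<beta> \<gamma>)"
  define S where "S = (\<lambda>x. antichain_of a ` Q x) ` F"
  define M where "M = (\<lambda>c. antichain_of a ` paired_orbit a c) ` {1..a}"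
  define L where "L = {antichain_of a ` long_orbit a}"
  define G where "G = (\<lambda>c. antichain_of a ` giant_orbit a c) ` {1..<a}"
  let ?O = "antichain_orbits (fence_carrier a) (fence_order a)"
  let ?hat = "chi_hat (fence_carrier a) (fence_order a)"
  have cycS: "cyclic_on (step a) (Q x)" and stS: "Q x \<subseteq> {s. valid_state a s}" if "x \<in> F" for x
  proof -
    obtain \<alpha> \<beta> \<gamma> where x: "x = (\<alpha>, \<beta>, \<gamma>)" by (cases x)
    with that have b: "\<alpha> \<in> {1..<a}" "\<beta> \<in> {1..<a}" "\<gamma> \<in> {1..<a}" by (auto simp: F_def)
    show "cyclic_on (step a) (Q x)" "Q x \<subseteq> {s. valid_state a s}"
      unfolding x Q_def prod.case by (rule cyclic_on_free_orbit[OF assms b] free_orbit_states[OF assms])+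
  qed
  note cycM = cyclic_on_paired_orbit[OF assms] and stM = paired_orbit_states[OF assms]
  note cycL = cyclic_on_long_orbit[OF assms] and stL = long_orbit_states[OF assms]
  note cycG = cyclic_on_giant_orbit[OF assms] and stG = giant_orbit_states[OF assms]
  note orbS = antichain_orbit[OF assms cycS stS] and orbM = antichain_orbit[OF assms cycM stM]
    and orbL = antichain_orbit[OF assms cycL stL] and orbG = antichain_orbit[OF assms cycG stG]
  have union: "S \<union> M \<union> L \<union> G = ?O"
  proof
    show "S \<union> M \<union> L \<union> G \<subseteq> ?O"
      unfolding S_def M_def L_def G_def using orbS(2) orbM(2) orbL(2) orbG(2) by blast
    show "?O \<subseteq> S \<union> M \<union> L \<union> G"
    proof
      fix Orb assume "Orb \<in> ?O"
      then obtain s where s: "valid_state a s"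
        and Orb: "Orb = orbit (rowmotion (fence_carrier a) (fence_order a)) (antichain_of a s)"
        unfolding antichain_orbits_def antichain_of_image[OF assms, symmetric] by blast
      from orbit_cover[OF assms s]
      consider x where "x \<in> F" "s \<in> Q x" | c where "c \<in> {1..a}" "s \<in> paired_orbit a c"
        | "s \<in> long_orbit a" | c where "c \<in> {1..<a}" "s \<in> giant_orbit a c"
        unfolding F_def Q_def by fast
      then show "Orb \<in> S \<union> M \<union> L \<union> G"
      proof cases
        case 1
        then have "Orb = antichain_of a ` Q x" unfolding Orb by (intro orbS(1)) auto
        then show ?thesis using 1 unfolding S_def by blast
      next
        case 2
        then have "Orb = antichain_of a ` paired_orbit a c" unfolding Orb by (intro orbM(1)) auto
        then show ?thesis using 2 unfolding M_def by blast
      next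
        case 3
        then have "Orb = antichain_of a ` long_orbit a" unfolding Orb by (intro orbL(1)) auto
        then show ?thesis unfolding L_def by blast
      next
        case 4
        then have "Orb = antichain_of a ` giant_orbit a c" unfolding Orb by (intro orbG(1)) auto
        then show ?thesis using 4 unfolding G_def by blast
      qed
    qed
  qed
  \<comment> \<open>Natural subtraction is removed before the polynomial identities are checked over
    the integers; \<open>b - 1\<close> is exact because \<open>b\<close> is positive.\<close>
  have int_b: "int b = int a - 1" "int (b - 1) = int a - 2" using a b0 by auto
  have cardS: "card Orb = a" and chiS: "int (chi Orb) = 4 * int a - 4"
    and hatS: "int (?hat Orb) = 2 * int a ^ 2 - int a" if Orb: "Orb \<in> S" for Orb
  proof -
    obtain \<alpha> \<beta> \<gamma> where x: "(\<alpha>, \<beta>, \<gamma>) \<in> F" "Orb = antichain_of a ` Q (\<alpha>, \<beta>, \<gamma>)"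
      using Orb unfolding S_def by auto
    then have b: "\<alpha> \<in> {1..<a}" "\<beta> \<in> {1..<a}" "\<gamma> \<in> {1..<a}" by (auto simp: F_def)
    note sums = sum_free_orbit[OF a b0 b]
    have Q: "Q (\<alpha>, \<beta>, \<gamma>) = free_orbit a \<alpha> \<beta> \<gamma>" by (simp add: Q_def)
    show "card Orb = a" "int (chi Orb) = 4 * int a - 4" "int (?hat Orb) = 2 * int a ^ 2 - int a"
      unfolding x(2) orbS(3-5)[OF x(1) x(1)] unfolding Q sums
      by (simp_all add: int_b algebra_simps power2_eq_square)
  qed
  have cardM: "card Orb = a + 1" and chiM: "int (chi Orb) = 4 * int a - 2"
    and hatM: "int (?hat Orb) = 2 * int a ^ 2 + 3 * int a - 1" if Orb: "Orb \<in> M" for Orb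
  proof -
    obtain c where x: "c \<in> {1..a}" "Orb = antichain_of a ` paired_orbit a c"
      using Orb unfolding M_def by auto
    show "card Orb = a + 1" "int (chi Orb) = 4 * int a - 2" "int (?hat Orb) = 2 * int a ^ 2 + 3 * int a - 1"
      unfolding x(2) orbM(3-5)[OF x(1)] sum_paired_orbit[OF a b0]
      by (simp_all add: int_b algebra_simps power2_eq_square)
  qed
  have cardL: "card Orb = a ^ 2 + a + 1" and chiL: "int (chi Orb) = 4 * int a ^ 2 - int a"
    and hatL: "int (?hat Orb) = 2 * int a ^ 3 + 3 * int a - 1" if Orb: "Orb \<in> L" for Orb
  proof -
    have x: "Orb = antichain_of a ` long_orbit a" using Orb unfolding L_def by auto
    have "int (card Orb) = int (a ^ 2 + a + 1)"
      unfolding x orbL(3-5) sum_long_orbit[OF a b0]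
      by (simp add: int_b algebra_simps power2_eq_square)
    then show "card Orb = a ^ 2 + a + 1" by (simp only: of_nat_eq_iff)
    show "int (chi Orb) = 4 * int a ^ 2 - int a" "int (?hat Orb) = 2 * int a ^ 3 + 3 * int a - 1"
      unfolding x orbL(3-5) sum_long_orbit[OF a b0]
      unfolding of_nat_add of_nat_mult of_nat_Suc of_nat_numeral of_nat_1 int_b
      by (simp_all add: algebra_simps power2_eq_square power3_eq_cube)
  qed
  have cardG: "card Orb = 3 * a ^ 2 + a" and chiG: "int (chi Orb) = 12 * int a ^ 2 - 11 * int a + 2"
    and hatG: "int (?hat Orb) = 6 * int a ^ 3 - int a" if Orb: "Orb \<in> G" for Orb
  proof -
    obtain c where x: "c \<in> {1..<a}" "Orb = antichain_of a ` giant_orbit a c"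
      using Orb unfolding G_def by auto
    note sums = sum_giant_orbit[OF a b0 x(1)]
    have "int (card Orb) = int (3 * a ^ 2 + a)"
      unfolding x(2) orbG(3-5)[OF x(1) x(1)] sums
      unfolding of_nat_add of_nat_mult of_nat_Suc of_nat_numeral of_nat_1 of_nat_power int_b
      by (simp add: algebra_simps power2_eq_square)
    then show "card Orb = 3 * a ^ 2 + a" by (simp only: of_nat_eq_iff)
    show "int (chi Orb) = 12 * int a ^ 2 - 11 * int a + 2" "int (?hat Orb) = 6 * int a ^ 3 - int a"
      unfolding x(2) orbG(3-5)[OF x(1) x(1)] sums
      unfolding of_nat_add of_nat_mult of_nat_Suc of_nat_numeral of_nat_1 int_b
      by (simp_all add: algebra_simps power2_eq_square power3_eq_cube)
  qed
  \<comment> \<open>With \<open>a ^ 2\<close> as an atom, this bound separates the four sizes by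
    linear arithmetic. Their distinctness gives the disjointness of the four sets and reduces
    homometry to orbits of the same set.\<close>
  have "2 * a \<le> a ^ 2" using assms by (simp add: power2_eq_square)
  then have distinct: "a \<noteq> a ^ 2 + a + 1" "a \<noteq> 3 * a ^ 2 + a" "a + 1 \<noteq> a ^ 2 + a + 1"
      "a + 1 \<noteq> 3 * a ^ 2 + a" "a ^ 2 + a + 1 \<noteq> 3 * a ^ 2 + a"
    using assms by presburger+
  have disj: "X \<inter> Y = {}" if "\<forall>Orb\<in>X. card Orb = m" "\<forall>Orb\<in>Y. card Orb = n" "m \<noteq> n"
    for X Y :: "nat set set set" and m n
    using that by force
  have a1: "a \<noteq> a + 1" by simp
  have cards: "\<forall>Orb\<in>S. card Orb = a" "\<forall>Orb\<in>M. card Orb = a + 1"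
    "\<forall>Orb\<in>L. card Orb = a ^ 2 + a + 1" "\<forall>Orb\<in>G. card Orb = 3 * a ^ 2 + a"
    using cardS cardM cardL cardG by blast+
  have disjoint: "S \<inter> M = {}" "S \<inter> L = {}" "S \<inter> G = {}" "M \<inter> L = {}" "M \<inter> G = {}" "L \<inter> G = {}"
    using disj[OF cards(1) cards(2) a1] disj[OF cards(1) cards(3) distinct(1)] disj[OF cards(1) cards(4) distinct(2)]
      disj[OF cards(2) cards(3) distinct(3)] disj[OF cards(2) cards(4) distinct(4)] disj[OF cards(3) cards(4) distinct(5)]
    by simp_all
  have "card S = card F"
    unfolding S_def using stS inj_free_orbit[OF assms]
    by (intro card_orbit_family[OF assms]) (auto simp: F_def Q_def)
  then have numS: "card S = (a - 1) ^ 3"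
    by (simp add: F_def card_cartesian_product power3_eq_cube)
  have numM: "card M = a"
    unfolding M_def using card_orbit_family[OF assms stM inj_paired_orbit[OF assms]] by simp
  have numG: "card G = a - 1"
    unfolding G_def using card_orbit_family[OF assms stG inj_giant_orbit[OF assms]] by simp
  \<comment> \<open>Equal sizes force both orbits into the same set, on which the two sums are
    constant.\<close>
  have stats: "chi O1 = chi O2 \<and> ?hat O1 = ?hat O2"
    if "O1 \<in> ?O" "O2 \<in> ?O" "card O1 = card O2" for O1 O2
  proof -
    have no: "\<not> (O1 \<in> X \<and> O2 \<in> Y)" "\<not> (O1 \<in> Y \<and> O2 \<in> X)"
      if "\<forall>Orb\<in>X. card Orb = m" "\<forall>Orb\<in>Y. card Orb = n" "m \<noteq> n" for X Y m n
      using that \<open>card O1 = card O2\<close> by auto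
    have "O1 \<in> S \<or> O1 \<in> M \<or> O1 \<in> L \<or> O1 \<in> G" "O2 \<in> S \<or> O2 \<in> M \<or> O2 \<in> L \<or> O2 \<in> G"
      using that(1,2) union by blast+
    then have "O1 \<in> S \<and> O2 \<in> S \<or> O1 \<in> M \<and> O2 \<in> M \<or> O1 \<in> L \<and> O2 \<in> L \<or> O1 \<in> G \<and> O2 \<in> G"
      using no[OF cards(1) cards(2) a1] no[OF cards(1) cards(3) distinct(1)] no[OF cards(1) cards(4) distinct(2)]
        no[OF cards(2) cards(3) distinct(3)] no[OF cards(2) cards(4) distinct(4)] no[OF cards(3) cards(4) distinct(5)]
      by blast
    then have "int (chi O1) = int (chi O2) \<and> int (?hat O1) = int (?hat O2)"
      by (elim disjE conjE) (simp_all only: chiS chiM chiL chiG hatS hatM hatL hatG)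
    then show ?thesis by simp
  qed
  have hom: "homometric ?O card"
    unfolding homometric_def
  proof (intro ballI impI)
    fix O1 O2 assume "O1 \<in> ?O" "O2 \<in> ?O" "card O1 = card O2"
    from stats[OF this] show "sum card O1 = sum card O2" by (simp add: chi_def)
  qed
  have hom_hat: "homometric (ideal_orbits (fence_carrier a) (fence_order a)) card"
    unfolding homometric_def
  proof (intro ballI impI)
    fix I1 I2 assume I: "I1 \<in> ideal_orbits (fence_carrier a) (fence_order a)"
      "I2 \<in> ideal_orbits (fence_carrier a) (fence_order a)" "card I1 = card I2"
    let ?J = "ideal_orbit (fence_carrier a) (fence_order a)"
    \<comment> \<open>Every orbit of ideals comes from an orbit of antichains of the same size, so
      the claim is pulled back to the latter.\<close>
    have eq: "ideal_orbits (fence_carrier a) (fence_order a) = ?J ` ?O"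
      using bij_betw_ideal_orbit[OF fence_carrier_finite partial_order_on_fence] by (simp add: bij_betw_def)
    obtain O1 where O1: "I1 = ?J O1" "O1 \<in> ?O" using I(1) unfolding eq by (rule imageE)
    obtain O2 where O2: "I2 = ?J O2" "O2 \<in> ?O" using I(2) unfolding eq by (rule imageE)
    have "card O1 = card O2"
      using I(3) unfolding O1(1) O2(1) card_ideal_orbit[OF fence_carrier_finite partial_order_on_fence O1(2)]
        card_ideal_orbit[OF fence_carrier_finite partial_order_on_fence O2(2)] .
    from stats[OF O1(2) O2(2) this] show "sum card I1 = sum card I2"
      unfolding O1(1) O2(1) by (simp add: chi_hat_def)
  qed
  have numL: "card L = 1" by (simp add: L_def)
  show ?thesis
    by (rule exI[of _ S], rule exI[of _ M], rule exI[of _ L], rule exI[of _ G],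
        intro conjI ballI union disjoint numS numM numL numG hom hom_hat cardS cardM cardL cardG
        chiS chiM chiL chiG hatS hatM hatL hatG)
qed

end
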